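(* Consider the closed-loop MTDC system with $n$ DC buses described in the context, consisting of the voltage dynamics $$C_i \dot V_i = -\sum_{j\in\mathcal N_i}\frac{1}{R_{ij}}(V_i-V_j)+I_i^{\mathrm{inj}}+u_i,\qquad i=1,\dots,n,$$ with constant injected currents $I^{\mathrm{inj}}=[I_1^{\mathrm{inj}},\dots,I_n^{\mathrm{inj}}]^T$, where $u_i$ is given by the distributed controller $$u_i=-K_i^P(V_i-\hat V_i-\bar V_i),$$ $$\dot{\hat V}_i=-\gamma\sum_{j\in\mathcal N_i^c}c_{ij}\big((\hat V_i+\bar V_i-V_i)-(\hat V_j+\bar V_j-V_j)\big),$$ $$\dot{\bar V}_i=-K_i^V(V_i-V_i^{\mathrm{nom}})-\delta\sum_{j\in\mathcal N_i^c}c_{ij}(\bar V_i-\bar V_j).$$ Let $f_1,\dots,f_n>0$, $F=\mathrm{diag}([f_1,\dots,f_n])$, and let $K^P=\mathrm{diag}([K_1^P,\dots,K_n^P])=F^{-1}$. Then the matrix $$A=\begin{bmatrix}-\delta\mathcal L_C & 0_{n\times n} & -K^V\\ -\gamma\mathcal L_C & -\gamma\mathcal L_C & \gamma\mathcal L_C\\ CK^P & CK^P & -C(\mathcal L_R+K^P)\end{bmatrix}$$ has one eigenvalue equal to $0$. If all other eigenvalues of $A$ lie in the open complex left half plane, then: 1. $\displaystyle\lim_{t\to\infty}\sum_{i=1}^n K_i^V\big(V_i(t)-V_i^{\mathrm{nom}}\big)=0$; 2. $\displaystyle\lim_{t\to\infty}u(t)=u^*$, where $u=[u_1,\dots,u_n]^T$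 and $u^*$ is the $u$-component of $$[u^*,V^*]=\arg\min_{[u,V]}\ \sum_{i=1}^n\tfrac12 f_iu_i^2\quad\text{subject to}\quad \mathcal L_RV=I^{\mathrm{inj}}+u.$$ Moreover, the relative voltage differences are bounded and satisfy $$\lim_{t\to\infty}|V_i(t)-V_j(t)|\le 2I^{\max}\sum_{k=2}^n\frac1{\lambda_k}\qquad\text{for all } i,j\in\{1,\dots,n\},$$ where $I^{\mathrm{tot}}=I^{\mathrm{inj}}+\lim_{t\to\infty}u(t)$, $I^{\max}=\max_i|I_i^{\mathrm{tot}}|$, and $\lambda_k$ denotes the $k$-th eigenvalue of $\mathcal L_R$.
   Context: The MTDC transmission network is a static, undirected, connected graph on the vertex set $\mathcal V=\{1,\dots,n\}$ (DC buses), whose edges are HVDC lines with resistances $R_{ij}=R_{ji}>0$; $\mathcal N_i$ is the set of neighbours of bus $i$ in this graph. $V_i(t)$ is the voltage of bus $i$, $C_i>0$ its capacity, $I_i^{\mathrm{inj}}$ the (constant) nominal injected current, $u_i$ the controlled injected current and $V_i^{\mathrm{nom}}$ the constant nominal voltage. $\mathcal L_R$ is the weighted Laplacian matrix of the network with edge weights $1/R_{ij}$; its eigenvalues are ordered as $0=\lambda_1<\lambda_2\le\dots\le\lambda_n$. The communication network is a static, undirected, connected graph $\mathcal G_c$ on the same vertex set with edge weights $c_{ij}=c_{ji}>0$; $\mathcal N_i^c$ is the set of neighbours of $i$ in $\mathcal G_c$ and $\mathcal L_C$ is the corresponding weighted Laplacian matrix. The scalars $\hat V_i,\bar V_i$ are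 controller states; the controller gains $\gamma,\delta,K_i^P,K_i^V$ are positive. Notation: $C=\mathrm{diag}([C_1^{-1},\dots,C_n^{-1}])$ (note the inverses), $K^V=\mathrm{diag}([K_1^V,\dots,K_n^V])$, and $0_{n\times n}$ is the $n\times n$ zero matrix. With $V=[V_1,\dots,V_n]^T$, etc., the closed loop is the linear system $\frac{d}{dt}[\bar V^T,\hat V^T,V^T]^T=A[\bar V^T,\hat V^T,V^T]^T+b$ with $b=[(K^VV^{\mathrm{nom}})^T,0_n^T,(CI^{\mathrm{inj}})^T]^T$, where $0_n$ is the zero column vector of length $n$. "All other eigenvalues" means the remaining $3n-1$ eigenvalues counted with algebraic multiplicity. The limits are along any solution of the closed-loop system. *)

theory Defs
  imports
    Complex_Main
    "HOL-Library.Multiset"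
    "HOL-Computational_Algebra.Polynomial"
    "Jordan_Normal_Form.Char_Poly"
begin

text \<open>
  Buses are numbered \<open>0, \<dots>, n - 1\<close>, matching the indexing of vectors and matrices.
  An undirected graph is given by its symmetric adjacency relation, so the neighbours of \<open>i\<close>
  are \<open>E `` {i}\<close>.
\<close>

definition undirected_connected_graph :: "nat \<Rightarrow> nat rel \<Rightarrow> bool" where
  "undirected_connected_graph n E \<longleftrightarrow>
     E \<subseteq> {..<n} \<times> {..<n} \<and> sym E \<and> irrefl E \<and> (\<forall>i<n. \<forall>j<n. (i, j) \<in> E\<^sup>*)"

definition edge_weights :: "nat rel \<Rightarrow> (nat \<Rightarrow> nat \<Rightarrow> real) \<Rightarrow> bool" where
  "edge_weights E w \<longleftrightarrow> (\<forall>(i, j) \<in> E. w i j = w j i \<and> 0 < w i j)"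

definition weighted_laplacian :: "nat \<Rightarrow> nat rel \<Rightarrow> (nat \<Rightarrow> nat \<Rightarrow> real) \<Rightarrow> real mat" where
  "weighted_laplacian n E w = mat n n (\<lambda>(i, j).
     if i = j then \<Sum>k\<in>E `` {i}. w i k
     else if (i, j) \<in> E then - w i j else 0)"

text \<open>Square block matrix from a list of block rows; all blocks are \<open>n \<times> n\<close>.\<close>

definition block_matrix :: "nat \<Rightarrow> 'a mat list list \<Rightarrow> 'a mat" where
  "block_matrix n Bs = mat (length Bs * n) (length Bs * n)
     (\<lambda>(i, j). Bs ! (i div n) ! (j div n) $$ (i mod n, j mod n))"

text \<open>The capacity matrix has the inverses of the capacities on its diagonal.\<close>

definition capacity_matrix :: "nat \<Rightarrow> (nat \<Rightarrow> real) \<Rightarrow> real mat" where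
  "capacity_matrix n cap = mat_diag n (\<lambda>i. inverse (cap i))"

text \<open>The state is ordered as \<open>(Vbar, Vhat, V)\<close>.\<close>

definition closed_loop_matrix ::
  "nat \<Rightarrow> real \<Rightarrow> real \<Rightarrow> real mat \<Rightarrow> real mat \<Rightarrow> real mat \<Rightarrow> real mat \<Rightarrow> real mat \<Rightarrow> real mat" where
  "closed_loop_matrix n \<gamma> \<delta> LR LC C KP KV = block_matrix n
     [[(- \<delta>) \<cdot>\<^sub>m LC, 0\<^sub>m n n,       - KV           ],
      [(- \<gamma>) \<cdot>\<^sub>m LC, (- \<gamma>) \<cdot>\<^sub>m LC, \<gamma> \<cdot>\<^sub>m LC       ],
      [C * KP,       C * KP,       - (C * (LR + KP))]]"

text \<open>Eigenvalues in the coefficient field, counted with algebraic multiplicity. A real matrix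
  has to be mapped into the complex numbers to obtain its full spectrum.\<close>

definition eigenvalue_mset :: "'a :: idom mat \<Rightarrow> 'a multiset" where
  "eigenvalue_mset A = proots (char_poly A)"

text \<open>The \<open>k\<close>-th smallest real eigenvalue, counting from \<open>k = 1\<close>. It is only used for symmetric
  matrices, whose eigenvalues are all real.\<close>

definition ordered_eigenvalue :: "real mat \<Rightarrow> nat \<Rightarrow> real" where
  "ordered_eigenvalue A k = sorted_list_of_multiset (eigenvalue_mset A) ! (k - 1)"

definition optimal_injection ::
  "nat \<Rightarrow> (nat \<Rightarrow> real) \<Rightarrow> real mat \<Rightarrow> real vec \<Rightarrow> real vec \<times> real vec \<Rightarrow> bool" where
  "optimal_injection n f LR Iinj = is_arg_min
     (\<lambda>(u, V). \<Sum>i<n. 1 / 2 * f i * (u $ i)\<^sup>2)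
     (\<lambda>(u, V). u \<in> carrier_vec n \<and> V \<in> carrier_vec n \<and> LR *\<^sub>v V = Iinj + u)"

end

theory Submission
  imports Defs "Jordan_Normal_Form.Schur_Decomposition"
begin

text \<open>
  The kernel of the closed-loop matrix \<open>A\<close> is spanned by \<open>(1, -1, 0)\<close> and its left kernel by
  \<open>(0, 1, 0)\<close>: both follow from the two facts that a Laplacian annihilates exactly the constants
  on a connected graph and that its values sum to zero (lemmas \<open>A_right_kernel\<close> and
  \<open>A_left_kernel\<close>). The pairing of the two vectors is \<open>-n\<close>, which is nonzero, and this is what makes
  the zero eigenvalue algebraically simple: were it double, a Schur form with zeros in both corners
  of the diagonal would make a right null vector orthogonal to a left one
  (\<open>zero_eigenvalue_simple\<close>).

  The constant input of the system has second block zero, so the left null vector annihilates it. In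
  a Schur form whose last diagonal entry is the zero eigenvalue, the last coordinate is therefore
  constant in time, and the remaining ones, solved from the bottom up, are stable scalar equations
  with convergent forcing. Hence every trajectory converges (\<open>solution_converges\<close>), and its limit is
  an equilibrium because a convergent function whose derivative converges has derivative limit zero.

  At the equilibrium the quantity \<open>Vbar + Vhat - V\<close> is annihilated by \<open>LC\<close>, so it is a constant
  \<open>\<alpha>\<close> and the injection is \<open>KP\<^sub>i \<alpha>\<close>. All marginal costs \<open>f\<^sub>i u\<^sub>i\<close> then equal \<open>\<alpha>\<close>, which
  characterises the optimal injection because feasibility fixes the total injection
  (\<open>optimal_injection_iff\<close>). Summing the equilibrium equation of \<open>Vbar\<close> gives the weighted voltage
  balance.

  For the voltage differences let \<open>h\<close> be the potential produced by a unit current from bus \<open>i\<close> to bus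
  \<open>j\<close>, and let \<open>I\<close> be the injected current, bounded by \<open>m\<close>. Since the currents sum to zero,
  \<open>2n (V\<^sub>i - V\<^sub>j)\<close> is the sum of \<open>(h\<^sub>a - h\<^sub>b) (I\<^sub>a - I\<^sub>b)\<close> over all pairs \<open>(a, b)\<close>. Reciprocity and
  the maximum principle bound \<open>\<bar>h\<^sub>a - h\<^sub>b\<bar>\<close> by the effective resistance between \<open>a\<close> and \<open>b\<close>, and the
  sum of the effective resistances over all ordered pairs is \<open>2n\<close> times the sum of the \<open>1 / \<lambda>\<^sub>k\<close>
  with \<open>k \<ge> 2\<close> (\<open>potential_difference_bound\<close>).
\<close>

section \<open>Triangular matrices and Schur form\<close>

text \<open>
  The inverse of a triangular matrix is triangular, as back substitution from the last row upwards
  shows, so its diagonal consists of the reciprocals of the diagonal entries.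
\<close>

lemma triangular_inverse_trace:
  fixes U X :: "'a :: field mat"
  assumes U: "U \<in> carrier_mat N N" and X: "X \<in> carrier_mat N N"
    and tri: "upper_triangular U" and inv: "U * X = 1\<^sub>m N"
  shows "(\<Sum>i<N. X $$ (i, i)) = (\<Sum>i<N. 1 / U $$ (i, i))"
proof -
  have entry: "(\<Sum>k<N. U $$ (i, k) * X $$ (k, j)) = (if i = j then 1 else 0)" if "i < N" "j < N" for i j
  proof -
    have "(U * X) $$ (i, j) = (\<Sum>k<N. U $$ (i, k) * X $$ (k, j))"
      using that U X by (simp add: scalar_prod_def atLeast0LessThan)
    then show ?thesis using inv that by simp
  qed
  have pivot: "U $$ (i, i) * X $$ (i, j) = (if i = j then 1 else 0)"
    if "i < N" "j \<le> i" and below: "\<And>k. i < k \<Longrightarrow> k < N \<Longrightarrow> X $$ (k, j) = 0" for i j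
  proof -
    have "(\<Sum>k<N. U $$ (i, k) * X $$ (k, j)) = (\<Sum>k<N. if k = i then U $$ (i, i) * X $$ (i, j) else 0)"
    proof (rule sum.cong)
      fix k assume "k \<in> {..<N}"
      then show "U $$ (i, k) * X $$ (k, j) = (if k = i then U $$ (i, i) * X $$ (i, j) else 0)"
        using tri U below[of k] that(1) by (cases k i rule: linorder_cases) auto
    qed simp
    then show ?thesis using entry[of i j] that by simp
  qed
  have lower: "X $$ (i, j) = 0" if "i < N" "j < i" for i j
    using that
  proof (induction "N - i" arbitrary: i j rule: less_induct)
    case less
    then have IH: "X $$ (k, l) = 0" if "i < k" "k < N" "l \<le> i" for k l
      using less.hyps[of k l] that by auto
    have "U $$ (i, i) * X $$ (i, i) = 1" using pivot[of i i] IH[of _ i] less.prems by auto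
    moreover have "U $$ (i, i) * X $$ (i, j) = 0" using pivot[of i j] IH[of _ j] less.prems by auto
    ultimately show ?case by auto
  qed
  show ?thesis
  proof (rule sum.cong)
    fix i assume "i \<in> {..<N}"
    then have "U $$ (i, i) * X $$ (i, i) = 1" using pivot[of i i] lower by auto
    then show "X $$ (i, i) = 1 / U $$ (i, i)" by (metis nonzero_eq_divide_eq mult.commute mult_zero_left zero_neq_one)
  qed simp
qed

lemma mat_mult_entry:
  assumes "A \<in> carrier_mat n m" "B \<in> carrier_mat m l" "i < n" "j < l"
  shows "(A * B) $$ (i, j) = (\<Sum>k<m. A $$ (i, k) * B $$ (k, j))"
  using assms by (simp add: scalar_prod_def atLeast0LessThan)

lemma trace_commute:
  fixes A B :: "'a :: comm_semiring_1 mat"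
  assumes "A \<in> carrier_mat n n" "B \<in> carrier_mat n n"
  shows "(\<Sum>i<n. (A * B) $$ (i, i)) = (\<Sum>i<n. (B * A) $$ (i, i))"
proof -
  have "(\<Sum>i<n. (A * B) $$ (i, i)) = (\<Sum>i<n. \<Sum>k<n. A $$ (i, k) * B $$ (k, i))"
    using assms by (simp add: mat_mult_entry del: index_mult_mat)
  also have "\<dots> = (\<Sum>k<n. \<Sum>i<n. B $$ (k, i) * A $$ (i, k))"
    by (subst sum.swap) (simp add: mult.commute)
  finally show ?thesis using assms by (simp add: mat_mult_entry del: index_mult_mat)
qed

lemma proots_linear_factors: "proots (\<Prod>e\<leftarrow>es. [:- e, 1:]) = mset (es :: 'a :: idom list)"
proof (induction es)
  case (Cons e es)
  have "(\<Prod>e\<leftarrow>es. [:- e, 1:]) \<noteq> 0" by (auto simp: prod_list_zero_iff)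
  then have "proots ([:- e, 1:] * (\<Prod>e\<leftarrow>es. [:- e, 1:])) = {#e#} + mset es"
    using Cons by (subst proots_mult) auto
  then show ?case by simp
qed simp

text \<open>
  The eigenvalues may be listed in any order, and they then appear on the diagonal of \<open>T\<close> in that
  order; placing zero first or last turns the first column of \<open>P\<close> or the last row of \<open>Q\<close> into a null
  vector of \<open>A\<close>.
\<close>

lemma schur_form:
  fixes A :: "'a :: conjugatable_ordered_field mat"
  assumes A: "A \<in> carrier_mat N N" and cp: "char_poly A = (\<Prod>e\<leftarrow>es. [:- e, 1:])"
  obtains P T Q where "P \<in> carrier_mat N N" "T \<in> carrier_mat N N" "Q \<in> carrier_mat N N"
    "P * Q = 1\<^sub>m N" "Q * P = 1\<^sub>m N" "A * P = P * T" "Q * A = T * Q"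
    "upper_triangular T" "\<forall>i<N. T $$ (i, i) = es ! i" "length es = N"
proof -
  obtain T P Q where s: "schur_decomposition A es = (T, P, Q)" by (metis prod_cases3)
  have dec: "similar_mat_wit A T P Q" "upper_triangular T" "diag_mat T = es"
    using schur_decomposition[OF A cp s] by auto
  then have car: "P \<in> carrier_mat N N" "T \<in> carrier_mat N N" "Q \<in> carrier_mat N N"
    and PQ: "P * Q = 1\<^sub>m N" "Q * P = 1\<^sub>m N" and APTQ: "A = P * T * Q"
    using A by (auto simp: similar_mat_wit_def Let_def)
  have "A * P = P * T * (Q * P)" "Q * A = (Q * P) * T * Q"
    unfolding APTQ using car by (simp_all add: assoc_mult_mat[of _ N N _ N _ N])
  then have "A * P = P * T" "Q * A = T * Q" using PQ car by simp_all
  moreover have "length es = N" "\<forall>i<N. T $$ (i, i) = es ! i"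
    using dec(3) car by (auto simp: diag_mat_def)
  ultimately show ?thesis using that car PQ dec(2) by blast
qed

lemma mat_mult_vec_entry:
  assumes "A \<in> carrier_mat n m" "v \<in> carrier_vec m" "i < n"
  shows "(A *\<^sub>v v) $ i = (\<Sum>k<m. A $$ (i, k) * v $ k)"
  using assms by (simp add: scalar_prod_def atLeast0LessThan)

section \<open>Laplacian flow on a weighted connected graph\<close>

lemma sum_mult_delta: "(\<Sum>k<n. f k * (if k = a then 1 else 0)) = (if a < n then f a else (0 :: real))" for n a :: nat
  by (simp add: if_distrib[of "(*) _"] cong: if_cong)

locale connected_network =
  fixes n :: nat and E :: "nat rel" and w :: "nat \<Rightarrow> nat \<Rightarrow> real"
  assumes graph: "undirected_connected_graph n E" and weights: "edge_weights E w"
begin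

abbreviation laplacian :: "real mat" where
  "laplacian \<equiv> weighted_laplacian n E w"

text \<open>
  The net current that leaves node \<open>i\<close> at the potential \<open>x\<close>; it is the action of the Laplacian on
  functions.
\<close>

definition flow :: "(nat \<Rightarrow> real) \<Rightarrow> nat \<Rightarrow> real" where
  "flow x i = (\<Sum>j\<in>E `` {i}. w i j * (x i - x j))"

text \<open>
  Every edge is present in both orientations, hence the division by two.
\<close>

definition dirichlet :: "(nat \<Rightarrow> real) \<Rightarrow> (nat \<Rightarrow> real) \<Rightarrow> real" where
  "dirichlet x y = (\<Sum>(i, j)\<in>E. w i j * (x i - x j) * (y i - y j)) / 2"

lemma edge_bounds: "(i, j) \<in> E \<Longrightarrow> i < n \<and> j < n"
  using graph by (auto simp: undirected_connected_graph_def)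

lemma finite_edges: "finite E"
  using graph finite_subset[of E "{..<n} \<times> {..<n}"] by (auto simp: undirected_connected_graph_def)

lemma weight_sym: "(i, j) \<in> E \<Longrightarrow> w i j = w j i"
  and weight_pos: "(i, j) \<in> E \<Longrightarrow> 0 < w i j"
  using weights by (auto simp: edge_weights_def)

lemma edge_sym: "(i, j) \<in> E \<Longrightarrow> (j, i) \<in> E"
  using graph by (auto simp: undirected_connected_graph_def sym_def)

lemma finite_neighbours: "finite (E `` {i})"
  by (rule finite_subset[of _ "{..<n}"]) (auto dest: edge_bounds)

lemma flow_diff: "flow (\<lambda>k. x k - y k) i = flow x i - flow y i"
  by (simp add: flow_def sum_subtractf[symmetric] algebra_simps)

lemma flow_uminus: "flow (\<lambda>k. - x k) i = - flow x i"
  by (simp add: flow_def sum_negf[symmetric] algebra_simps)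

lemma sum_edges: "(\<Sum>i<n. \<Sum>j\<in>E `` {i}. g i j) = (\<Sum>(i, j)\<in>E. g i j)"
proof -
  have "(SIGMA i:{..<n}. E `` {i}) = E" by (auto dest: edge_bounds)
  then show ?thesis by (subst sum.Sigma) (auto simp: finite_neighbours)
qed

lemma sum_edges_swap: "(\<Sum>(i, j)\<in>E. g i j) = (\<Sum>(i, j)\<in>E. g j i)"
  by (rule sum.reindex_bij_witness[of _ prod.swap prod.swap]) (auto dest: edge_sym)

text \<open>
  Summation by parts: pairing each edge with its reversal antisymmetrises the test function.
\<close>

lemma green: "(\<Sum>i<n. y i * flow x i) = dirichlet x y"
proof -
  let ?S = "\<Sum>(i, j)\<in>E. y i * (w i j * (x i - x j))"
  have "(\<Sum>i<n. y i * flow x i) = ?S"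
    by (simp add: flow_def sum_distrib_left sum_edges)
  moreover have "?S = (\<Sum>(i, j)\<in>E. - (y j * (w i j * (x i - x j))))"
    by (subst sum_edges_swap, rule sum.cong) (auto simp: algebra_simps dest: weight_sym)
  then have "?S + ?S = ?S + (\<Sum>(i, j)\<in>E. - (y j * (w i j * (x i - x j))))"
    by simp
  then have "?S + ?S = (\<Sum>(i, j)\<in>E. w i j * (x i - x j) * (y i - y j))"
    unfolding sum.distrib[symmetric] case_prod_unfold by (simp add: algebra_simps)
  ultimately show ?thesis by (simp add: dirichlet_def)
qed

lemma dirichlet_commute: "dirichlet x y = dirichlet y x"
  by (simp add: dirichlet_def mult.assoc mult.commute[of "x _ - x _"])

lemma flow_self_adjoint: "(\<Sum>i<n. y i * flow x i) = (\<Sum>i<n. x i * flow y i)"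
  using green dirichlet_commute by metis

lemma sum_flow: "(\<Sum>i<n. flow x i) = 0"
  using green[of "\<lambda>_. 1" x] by (simp add: dirichlet_def)

lemma dirichlet_term_nonneg: "(i, j) \<in> E \<Longrightarrow> 0 \<le> w i j * (x i - x j) * (x i - x j)"
  using weight_pos[of i j] by (simp add: mult.assoc)

lemma dirichlet_nonneg: "0 \<le> dirichlet x x"
  unfolding dirichlet_def by (auto intro!: sum_nonneg dirichlet_term_nonneg)

lemma dirichlet_zero_imp_const:
  assumes "dirichlet x x \<le> 0" "i < n" "j < n"
  shows "x i = x j"
proof -
  have "(\<Sum>(i, j)\<in>E. w i j * (x i - x j) * (x i - x j)) = 0"
    using assms(1) dirichlet_nonneg[of x] by (simp add: dirichlet_def)
  then have "\<forall>e\<in>E. (case e of (i, j) \<Rightarrow> w i j * (x i - x j) * (x i - x j)) = 0"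
    by (subst (asm) sum_nonneg_eq_0_iff) (auto simp: finite_edges dirichlet_term_nonneg)
  then have edge: "x i = x j" if "(i, j) \<in> E" for i j
    using that weight_pos[OF that] by auto
  have "(i, j) \<in> E\<^sup>*" using graph assms by (auto simp: undirected_connected_graph_def)
  then show ?thesis by induction (auto dest: edge)
qed

lemma flow_zero_imp_const:
  assumes "\<forall>i<n. flow x i = 0"
  shows "\<exists>\<kappa>. \<forall>i<n. x i = \<kappa>"
proof -
  have "dirichlet x x = 0" using green[of x x] assms by simp
  then show ?thesis using dirichlet_zero_imp_const[of x] by (metis order_refl)
qed

lemma flow_const: "\<forall>i<n. x i = \<kappa> \<Longrightarrow> i < n \<Longrightarrow> flow x i = 0"
  by (auto simp: flow_def intro!: sum.neutral dest: edge_bounds)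

text \<open>
  Testing the flow with the excess \<open>y = max (x - x a) 0\<close>, which vanishes at \<open>a\<close>, shows that \<open>y\<close> has
  no Dirichlet energy; so \<open>y\<close> is constant and therefore zero.
\<close>

lemma maximum_principle:
  assumes le: "\<And>k. k < n \<Longrightarrow> k \<noteq> a \<Longrightarrow> flow x k \<le> 0" and "a < n" "k < n"
  shows "x k \<le> x a"
proof -
  define y where "y k = max (x k - x a) 0" for k
  have "dirichlet y y \<le> dirichlet x y"
    unfolding dirichlet_def
  proof (intro divide_right_mono sum_mono)
    fix e assume "e \<in> E"
    obtain i j where e: "e = (i, j)" by fastforce
    have "(y i - y j) * (y i - y j) \<le> (x i - x j) * (y i - y j)"
      by (auto simp: y_def max_def intro: mult_right_mono mult_right_mono_neg)
    then show "(case e of (i, j) \<Rightarrow> w i j * (y i - y j) * (y i - y j))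
        \<le> (case e of (i, j) \<Rightarrow> w i j * (x i - x j) * (y i - y j))"
      using weight_pos[of i j] \<open>e \<in> E\<close> by (simp add: e mult.assoc)
  qed simp
  also have "\<dots> \<le> 0"
    unfolding green[symmetric]
  proof (rule sum_nonpos)
    fix k assume k: "k \<in> {..<n}"
    have "y a = 0" "0 \<le> y k" by (auto simp: y_def)
    then show "y k * flow x k \<le> 0" using le[of k] k by (cases "k = a") (auto simp: mult_nonneg_nonpos)
  qed
  finally have "y k = y a" using dirichlet_zero_imp_const assms by blast
  then show ?thesis by (auto simp: y_def max_def split: if_splits)
qed

lemma minimum_principle:
  assumes "\<And>k. k < n \<Longrightarrow> k \<noteq> b \<Longrightarrow> 0 \<le> flow x k" "b < n" "k < n"
  shows "x b \<le> x k"
  using maximum_principle[of b "\<lambda>k. - x k" k] assms by (simp add: flow_uminus)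

lemma laplacian_carrier [simp]: "laplacian \<in> carrier_mat n n"
  by (simp add: weighted_laplacian_def)

lemma laplacian_row_sum:
  assumes "i < n"
  shows "(\<Sum>j<n. laplacian $$ (i, j) * x j) = flow x i"
proof -
  have irr: "(i, i) \<notin> E" using graph by (auto simp: undirected_connected_graph_def irrefl_def)
  have "(\<Sum>j<n. laplacian $$ (i, j) * x j)
      = (\<Sum>j<n. (if j = i then (\<Sum>k\<in>E `` {i}. w i k) * x i else 0) - (if (i, j) \<in> E then w i j * x j else 0))"
    using assms irr by (intro sum.cong) (auto simp: weighted_laplacian_def)
  also have "\<dots> = (\<Sum>k\<in>E `` {i}. w i k) * x i - (\<Sum>j<n. if j \<in> E `` {i} then w i j * x j else 0)"
    using assms by (simp add: sum_subtractf)
  also have "(\<Sum>j<n. if j \<in> E `` {i} then w i j * x j else 0) = (\<Sum>j\<in>E `` {i}. w i j * x j)"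
  proof -
    have *: "{..<n} \<inter> E `` {i} = E `` {i}" by (auto dest: edge_bounds)
    show ?thesis using sum.inter_restrict[of "{..<n}" "\<lambda>j. w i j * x j" "E `` {i}"] by (simp add: *)
  qed
  finally show ?thesis by (simp add: flow_def sum_distrib_right sum_subtractf right_diff_distrib)
qed

lemma laplacian_symmetric: "i < n \<Longrightarrow> j < n \<Longrightarrow> laplacian $$ (i, j) = laplacian $$ (j, i)"
  by (auto simp: weighted_laplacian_def weight_sym dest: edge_sym)

lemma laplacian_col_sum:
  "j < n \<Longrightarrow> (\<Sum>i<n. x i * laplacian $$ (i, j)) = flow x j"
  using laplacian_row_sum[of j x]
  by (simp add: laplacian_symmetric[of _ j] mult.commute)

section \<open>Spectrum of the Laplacian and the bound on voltage differences\<close>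

text \<open>
  Splitting an eigenvector into real and imaginary parts, self-adjointness of the flow kills the
  imaginary part of the eigenvalue, and the nonnegative Dirichlet energy gives the sign.
\<close>

lemma complex_eigenvalue_real_nonneg:
  assumes "poly (map_poly complex_of_real (char_poly laplacian)) z = 0"
  shows "Im z = 0 \<and> 0 \<le> Re z"
proof -
  let ?L = "map_mat complex_of_real laplacian"
  have L: "?L \<in> carrier_mat n n" by simp
  have "eigenvalue ?L z"
    using assms of_real_hom.char_poly_hom[OF laplacian_carrier, where ?'a = complex]
    by (simp add: eigenvalue_root_char_poly[OF L])
  then obtain v where v: "v \<in> carrier_vec n" "v \<noteq> 0\<^sub>v n" "?L *\<^sub>v v = z \<cdot>\<^sub>v v"
    by (auto simp: eigenvalue_def eigenvector_def weighted_laplacian_def)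
  define p q where "p i = Re (v $ i)" and "q i = Im (v $ i)" for i
  have row: "(\<Sum>k<n. complex_of_real (laplacian $$ (i, k)) * v $ k) = z * v $ i" if "i < n" for i
    using mat_mult_vec_entry[OF L v(1) that] v that laplacian_carrier by simp
  have fp: "flow p i = Re z * p i - Im z * q i" and fq: "flow q i = Im z * p i + Re z * q i"
    if "i < n" for i
    using arg_cong[OF row[OF that], of Re] arg_cong[OF row[OF that], of Im]
    by (simp_all add: laplacian_row_sum[symmetric] that p_def q_def)
  define N where "N = (\<Sum>i<n. p i * p i) + (\<Sum>i<n. q i * q i)"
  have "(\<Sum>i<n. q i * (Re z * p i - Im z * q i)) = (\<Sum>i<n. p i * (Im z * p i + Re z * q i))"
    using flow_self_adjoint[of q p] fp fq by simp
  then have im: "Im z * N = 0"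
    by (simp add: N_def algebra_simps sum_subtractf sum.distrib sum_distrib_left)
  have "0 \<le> (\<Sum>i<n. p i * flow p i) + (\<Sum>i<n. q i * flow q i)"
    by (simp add: green dirichlet_nonneg)
  also have "\<dots> = (\<Sum>i<n. p i * (Re z * p i - Im z * q i)) + (\<Sum>i<n. q i * (Im z * p i + Re z * q i))"
    using fp fq by simp
  also have "\<dots> = Re z * N"
    by (simp add: N_def algebra_simps sum_subtractf sum.distrib sum_distrib_left)
  finally have re: "0 \<le> Re z * N" .
  have "0 < N"
  proof -
    obtain i where i: "i < n" "v $ i \<noteq> 0" using v(1,2) by (metis carrier_vecD eq_vecI index_zero_vec)
    then have "0 < p i * p i + q i * q i"
      by (metis p_def q_def complex_eq_0 not_sum_power2_lt_zero power2_eq_square linorder_neqE_linordered_idom)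
    then show ?thesis
      unfolding N_def sum.distrib[symmetric] using i(1) by (intro sum_pos2[of _ i]) auto
  qed
  then show ?thesis using im re by (auto simp: zero_le_mult_iff)
qed

lemma laplacian_char_poly_splits:
  "\<exists>es. char_poly laplacian = (\<Prod>e\<leftarrow>es. [:- e, 1:]) \<and> length es = n \<and> (\<forall>e\<in>set es. 0 \<le> e)"
proof -
  let ?L = "map_mat complex_of_real laplacian"
  obtain zs where zs: "char_poly ?L = (\<Prod>z\<leftarrow>zs. [:- z, 1:])" "length zs = n"
    using char_poly_factorized[of ?L n] by auto
  have hom: "char_poly ?L = map_poly complex_of_real (char_poly laplacian)"
    by (rule of_real_hom.char_poly_hom[OF laplacian_carrier])
  have root: "Im z = 0 \<and> 0 \<le> Re z" if "z \<in> set zs" for z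
  proof (rule complex_eigenvalue_real_nonneg)
    show "poly (map_poly complex_of_real (char_poly laplacian)) z = 0"
      using that unfolding hom[symmetric] zs(1) by (auto simp: poly_prod_list prod_list_zero_iff)
  qed
  interpret poly_hom: map_poly_comm_ring_hom complex_of_real ..
  have "map_poly complex_of_real (\<Prod>e\<leftarrow>map Re zs. [:- e, 1:]) = (\<Prod>z\<leftarrow>zs. [:- z, 1:])"
    using root
  proof (induction zs)
    case (Cons z zs)
    have "complex_of_real (Re z) = z" using Cons.prems[of z] by (simp add: complex_eq_iff)
    then have "map_poly complex_of_real [:- Re z, 1:] = [:- z, 1:]" by simp
    moreover have "map_poly complex_of_real ([:- Re z, 1:] * q) = map_poly complex_of_real [:- Re z, 1:] * map_poly complex_of_real q" for q
      by (rule poly_hom.hom_mult)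
    ultimately show ?case using Cons by (simp del: mult_pCons_left)
  qed simp
  then have "map_poly complex_of_real (char_poly laplacian) = map_poly complex_of_real (\<Prod>e\<leftarrow>map Re zs. [:- e, 1:])"
    using hom zs by simp
  then have "char_poly laplacian = (\<Prod>e\<leftarrow>map Re zs. [:- e, 1:])"
    by (simp add: poly_eq_iff coeff_map_poly)
  then show ?thesis using zs(2) root by (intro exI[of _ "map Re zs"]) auto
qed


text \<open>
  Adding the all-ones matrix moves the eigenvalue of the constants from \<open>0\<close> to \<open>n\<close> and leaves the
  other eigenvalues alone, so the inverse of the sum takes the place of a pseudo-inverse of the
  Laplacian.
\<close>

definition shifted_laplacian :: "real mat" where
  "shifted_laplacian = laplacian + mat n n (\<lambda>_. 1)"

lemma shifted_laplacian_carrier [simp]: "shifted_laplacian \<in> carrier_mat n n"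
  by (simp add: shifted_laplacian_def)

lemma shifted_laplacian_row_sum:
  assumes "i < n"
  shows "(\<Sum>j<n. shifted_laplacian $$ (i, j) * x j) = flow x i + (\<Sum>j<n. x j)"
proof -
  have "(\<Sum>j<n. shifted_laplacian $$ (i, j) * x j) = (\<Sum>j<n. laplacian $$ (i, j) * x j + x j)"
    using assms by (intro sum.cong) (auto simp: shifted_laplacian_def distrib_right)
  then show ?thesis using assms by (simp add: sum.distrib laplacian_row_sum)
qed

lemma shifted_laplacian_invertible:
  obtains X where "X \<in> carrier_mat n n" "shifted_laplacian * X = 1\<^sub>m n" "X * shifted_laplacian = 1\<^sub>m n"
proof -
  have "det shifted_laplacian \<noteq> 0"
  proof
    assume "det shifted_laplacian = 0"
    then obtain v where v: "v \<in> carrier_vec n" "v \<noteq> 0\<^sub>v n" "shifted_laplacian *\<^sub>v v = 0\<^sub>v n"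
      using det_0_iff_vec_prod_zero_field[OF shifted_laplacian_carrier] by blast
    define x where "x i = v $ i" for i
    have row: "flow x i + (\<Sum>j<n. x j) = 0" if "i < n" for i
      using mat_mult_vec_entry[OF shifted_laplacian_carrier v(1) that] v(3) that
      by (simp add: x_def[symmetric] shifted_laplacian_row_sum)
    have "0 = (\<Sum>i<n. x i * (flow x i + (\<Sum>j<n. x j)))" using row by simp
    also have "\<dots> = dirichlet x x + (\<Sum>j<n. x j) * (\<Sum>j<n. x j)"
      by (simp add: distrib_left sum.distrib green sum_distrib_right)
    finally have "dirichlet x x \<le> 0" using zero_le_square[of "\<Sum>j<n. x j"] by linarith
    then have const: "x i = x j" if "i < n" "j < n" for i j
      using dirichlet_zero_imp_const that by blast
    have "x i = 0" if i: "i < n" for i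
    proof -
      have "flow x i = 0" using const[OF _ i] i by (intro flow_const[of _ "x i"]) blast+
      moreover have "(\<Sum>j<n. x j) = (\<Sum>j<n. x i)"
        by (rule sum.cong[OF refl], rule const[OF _ i]) simp
      ultimately show ?thesis using row[OF i] i by simp
    qed
    then show False using v(1,2) by (auto simp: x_def)
  qed
  from det_non_zero_imp_unit[OF shifted_laplacian_carrier this, of "()"] show ?thesis
    using that by (auto simp: Units_def ring_mat_def)
qed

lemma sorted_spectrum:
  assumes "0 < n"
  obtains es where "char_poly laplacian = (\<Prod>e\<leftarrow>es. [:- e, 1:])" "length es = n" "es ! 0 = 0"
    "\<And>k. ordered_eigenvalue laplacian k = es ! (k - 1)"
proof -
  obtain es' where es': "char_poly laplacian = (\<Prod>e\<leftarrow>es'. [:- e, 1:])" "length es' = n" "\<forall>e\<in>set es'. 0 \<le> e"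
    using laplacian_char_poly_splits by blast
  define es where "es = sort es'"
  have cp: "char_poly laplacian = (\<Prod>e\<leftarrow>es. [:- e, 1:])"
    unfolding es'(1) es_def prod_mset_prod_list[symmetric] by (simp flip: prod_mset_prod_list)
  have len: "length es = n" and nonneg: "\<forall>e\<in>set es. 0 \<le> e" and sorted: "sorted es"
    using es' by (simp_all add: es_def)
  have "eigenvalue laplacian 0"
    unfolding eigenvalue_def eigenvector_def
  proof (intro exI conjI)
    show "vec n (\<lambda>_. 1) \<in> carrier_vec (dim_row laplacian)" by (simp add: weighted_laplacian_def)
    show "vec n (\<lambda>_. 1 :: real) \<noteq> 0\<^sub>v (dim_row laplacian)"
      using assms by (auto simp: weighted_laplacian_def dest!: arg_cong[where f = "\<lambda>v. v $ 0"])
    show "laplacian *\<^sub>v vec n (\<lambda>_. 1) = 0 \<cdot>\<^sub>v vec n (\<lambda>_. 1)"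
    proof (rule eq_vecI)
      fix i assume "i < dim_vec (0 \<cdot>\<^sub>v vec n (\<lambda>_. 1 :: real))"
      then have i: "i < n" by simp
      have "(laplacian *\<^sub>v vec n (\<lambda>_. 1)) $ i = (\<Sum>j<n. laplacian $$ (i, j) * 1)"
        using mat_mult_vec_entry[OF laplacian_carrier _ i, of "vec n (\<lambda>_. 1)"] by simp
      also have "\<dots> = 0" using laplacian_row_sum[OF i, of "\<lambda>_. 1"] i by (simp add: flow_def)
      finally show "(laplacian *\<^sub>v vec n (\<lambda>_. 1)) $ i = (0 \<cdot>\<^sub>v vec n (\<lambda>_. 1)) $ i" using i by simp
    qed (simp add: weighted_laplacian_def)
  qed
  then have "0 \<in> set es"
    unfolding eigenvalue_root_char_poly[OF laplacian_carrier] cp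
    by (auto simp: poly_prod_list prod_list_zero_iff)
  then obtain i where "i < n" "es ! i = 0" using len by (auto simp: in_set_conv_nth)
  moreover have "es ! 0 \<le> es ! i" using sorted len \<open>i < n\<close> by (simp add: sorted_nth_mono)
  moreover have "0 \<le> es ! 0" using nonneg len assms by auto
  ultimately have "es ! 0 = 0" by simp
  moreover have "ordered_eigenvalue laplacian k = es ! (k - 1)" for k
    using sorted by (simp add: ordered_eigenvalue_def eigenvalue_mset_def cp proots_linear_factors sorted_sort_id)
  ultimately show ?thesis using that cp len by blast
qed

text \<open>
  In a Schur form of the Laplacian that starts with the eigenvalue zero, the first column of \<open>P\<close> is
  constant and all rows of \<open>Q\<close> but the first sum to zero. The all-ones matrix therefore becomes a
  matrix with a single nonzero row, the first, and the shifted Laplacian is triangularised by the same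
  \<open>P\<close> and \<open>Q\<close>.
\<close>

lemma trace_shifted_inverse:
  assumes n: "0 < n" and X: "X \<in> carrier_mat n n" and inv: "shifted_laplacian * X = 1\<^sub>m n"
  shows "(\<Sum>i<n. X $$ (i, i)) = 1 / n + (\<Sum>k = 2..n. 1 / ordered_eigenvalue laplacian k)"
proof -
  obtain es where es: "char_poly laplacian = (\<Prod>e\<leftarrow>es. [:- e, 1:])" "length es = n" "es ! 0 = 0"
    "\<And>k. ordered_eigenvalue laplacian k = es ! (k - 1)"
    using sorted_spectrum[OF n] by blast
  obtain P T Q where car: "P \<in> carrier_mat n n" "T \<in> carrier_mat n n" "Q \<in> carrier_mat n n"
    and PQ: "P * Q = 1\<^sub>m n" "Q * P = 1\<^sub>m n" and LP: "laplacian * P = P * T" "Q * laplacian = T * Q"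
    and tri: "upper_triangular T" and diag: "\<forall>i<n. T $$ (i, i) = es ! i"
    and "length es = n"
    by (rule schur_form[OF laplacian_carrier es(1)])
  let ?J = "mat n n (\<lambda>_. 1 :: real)"
  have "flow (\<lambda>k. P $$ (k, 0)) i = 0" if i: "i < n" for i
  proof -
    have "flow (\<lambda>k. P $$ (k, 0)) i = (laplacian * P) $$ (i, 0)"
      using i n car by (simp add: mat_mult_entry[OF laplacian_carrier] laplacian_row_sum del: index_mult_mat)
    also have "\<dots> = (\<Sum>k<n. P $$ (i, k) * T $$ (k, 0))"
      using i n car by (simp add: LP mat_mult_entry del: index_mult_mat)
    also have "\<dots> = 0"
    proof (rule sum.neutral, safe)
      fix k assume "k < n"
      then show "P $$ (i, k) * T $$ (k, 0) = 0"
        using upper_triangularD[OF tri, of 0 k] car diag[rule_format, of 0] es(3) by (cases "k = 0") auto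
    qed
    finally show ?thesis .
  qed
  then obtain \<kappa> where \<kappa>: "\<And>k. k < n \<Longrightarrow> P $$ (k, 0) = \<kappa>" using flow_zero_imp_const by blast
  have Qsum: "\<kappa> * (\<Sum>k<n. Q $$ (i, k)) = (if i = 0 then 1 else 0)" if i: "i < n" for i
  proof -
    have "(Q * P) $$ (i, 0) = \<kappa> * (\<Sum>k<n. Q $$ (i, k))"
      using i n car \<kappa> by (simp add: mat_mult_entry sum_distrib_left mult.commute del: index_mult_mat)
    then show ?thesis using PQ(2) i n by simp
  qed
  have "\<kappa> \<noteq> 0" using Qsum[OF n] by auto
  define U where "U = Q * shifted_laplacian * P"
  have U: "U \<in> carrier_mat n n" using car by (auto simp: U_def intro!: mult_carrier_mat)
  have "U = Q * laplacian * P + Q * ?J * P"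
    using car mult_carrier_mat[of _ n n _ n] by (simp add: U_def shifted_laplacian_def mult_add_distrib_mat[of _ n n _ n]
        add_mult_distrib_mat[of _ n n _ _ n])
  also have "Q * laplacian * P = T * (Q * P)"
    using car by (simp add: LP assoc_mult_mat[of _ n n _ n _ n] mult_carrier_mat[of _ n n _ n])
  finally have "U = T + Q * ?J * P" using PQ car by simp
  then have entry: "U $$ (i, j) = T $$ (i, j) + (\<Sum>k<n. Q $$ (i, k)) * (\<Sum>k<n. P $$ (k, j))"
    if "i < n" "j < n" for i j
    using that car mat_mult_entry[of "Q * ?J" n n P n i j] mat_mult_entry[of Q n n ?J n i]
    by (simp add: sum_distrib_left del: index_mult_mat(1))
  have triU: "upper_triangular U"
  proof (rule upper_triangularI)
    fix i j assume ji: "j < i" and "i < dim_row U"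
    then have i: "i < n" using U by simp
    then have "(\<Sum>k<n. Q $$ (i, k)) = 0" using Qsum[OF i] ji \<open>\<kappa> \<noteq> 0\<close> by simp
    moreover have "T $$ (i, j) = 0" using upper_triangularD[OF tri ji] i car by simp
    ultimately show "U $$ (i, j) = 0" using entry[OF i] ji i by simp
  qed
  have diagU: "U $$ (i, i) = (if i = 0 then real n else es ! i)" if i: "i < n" for i
  proof (cases "i = 0")
    case True
    have "U $$ (0, 0) = (\<Sum>k<n. Q $$ (0, k)) * (n * \<kappa>)"
      using entry[OF n n] diag[rule_format, OF n] es(3) \<kappa> by simp
    then show ?thesis using Qsum[OF n] True by (simp add: algebra_simps)
  next
    case False
    then show ?thesis using entry[OF i i] diag[rule_format, OF i] Qsum[OF i] \<open>\<kappa> \<noteq> 0\<close> by simp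
  qed
  have "U * (Q * X * P) = Q * shifted_laplacian * (P * Q) * X * P"
    using car X by (simp add: U_def assoc_mult_mat[of _ n n _ n _ n] mult_carrier_mat[of _ n n _ n])
  also have "\<dots> = Q * (shifted_laplacian * X) * P"
    using car X PQ by (simp add: assoc_mult_mat[of _ n n _ n _ n] mult_carrier_mat[of _ n n _ n])
  finally have invU: "U * (Q * X * P) = 1\<^sub>m n" using inv PQ car by simp
  have "P * (Q * X) = (P * Q) * X" using car X by (simp add: assoc_mult_mat[of _ n n _ n _ n] mult_carrier_mat[of _ n n _ n])
  then have "(\<Sum>i<n. X $$ (i, i)) = (\<Sum>i<n. (Q * X * P) $$ (i, i))"
    using trace_commute[of "Q * X" n P] car X PQ by simp
  also have "\<dots> = (\<Sum>i<n. 1 / U $$ (i, i))"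
    using triangular_inverse_trace[OF U _ triU invU] car X by simp
  also have "\<dots> = (\<Sum>i<n. if i = 0 then 1 / real n else 1 / es ! i)"
    using diagU by (intro sum.cong) auto
  also have "\<dots> = 1 / n + (\<Sum>i=1..<n. 1 / es ! i)"
    using n by (simp add: lessThan_atLeast0 sum.atLeast_Suc_lessThan)
  also have "(\<Sum>i=1..<n. 1 / es ! i) = (\<Sum>k = 2..n. 1 / ordered_eigenvalue laplacian k)"
    using sum.shift_bounds_Suc_ivl[of "\<lambda>k. 1 / es ! (k - 1)" 1 n]
    by (simp add: es(4) atLeastLessThanSuc_atLeastAtMost numeral_2_eq_2)
  finally show ?thesis .
qed

text \<open>
  Here \<open>r a b\<close> is the effective resistance between \<open>a\<close> and \<open>b\<close>, the potential drop caused by a unit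
  current from \<open>a\<close> to \<open>b\<close>. A unit current from \<open>i\<close> to \<open>j\<close> produces no larger drop between \<open>a\<close> and \<open>b\<close>:
  by reciprocity that drop equals the one between \<open>i\<close> and \<open>j\<close> for the current from \<open>a\<close> to \<open>b\<close>, whose
  potential is largest at \<open>a\<close> and smallest at \<open>b\<close>. The constant \<open>2 m\<close> bounds \<open>\<bar>I a - I b\<bar>\<close>.
\<close>

lemma potential_difference_bound:
  assumes "\<And>k. k < n \<Longrightarrow> flow x k = I k" and "\<And>k. k < n \<Longrightarrow> \<bar>I k\<bar> \<le> m" and i: "i < n" and j: "j < n"
  shows "\<bar>x i - x j\<bar> \<le> 2 * m * (\<Sum>k = 2..n. 1 / ordered_eigenvalue laplacian k)"
proof -
  have n: "0 < n" using i by simp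
  obtain X where X: "X \<in> carrier_mat n n" "shifted_laplacian * X = 1\<^sub>m n" "X * shifted_laplacian = 1\<^sub>m n"
    using shifted_laplacian_invertible by blast
  define g where "g a k = X $$ (k, a)" for a k
  have col: "flow (g a) k + (\<Sum>l<n. g a l) = (if k = a then 1 else 0)" if "a < n" "k < n" for a k
  proof -
    have "(shifted_laplacian * X) $$ (k, a) = (\<Sum>l<n. shifted_laplacian $$ (k, l) * g a l)"
      using that by (simp add: mat_mult_entry[OF shifted_laplacian_carrier X(1)] g_def del: index_mult_mat)
    then show ?thesis using that X(2) by (simp add: shifted_laplacian_row_sum)
  qed
  have mean: "(\<Sum>l<n. g a l) = 1 / n" if a: "a < n" for a
  proof -
    have "(\<Sum>k<n. flow (g a) k + (\<Sum>l<n. g a l)) = (\<Sum>k<n. if k = a then 1 else 0)"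
      using col[OF a] by (intro sum.cong) auto
    then have "n * (\<Sum>l<n. g a l) = 1" using a by (simp add: sum.distrib sum_flow)
    then show ?thesis using n by (simp add: field_simps)
  qed
  define h where "h a b k = g a k - g b k" for a b k
  have flow_h: "flow (h a b) k = (if k = a then 1 else 0) - (if k = b then 1 else 0)"
    if "a < n" "b < n" "k < n" for a b k
    using col[of a k] col[of b k] mean[of a] mean[of b] that unfolding h_def flow_diff by linarith
  define r where "r a b = h a b a - h a b b" for a b
  have resistance: "\<bar>h i j a - h i j b\<bar> \<le> r a b" if a: "a < n" and b: "b < n" for a b
  proof -
    \<comment> \<open>Reciprocity, from self-adjointness of the flow.\<close>
    have "h i j a - h i j b = (\<Sum>k<n. h i j k * flow (h a b) k)"
      using a b by (simp add: flow_h right_diff_distrib sum_subtractf sum_mult_delta)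
    also have "\<dots> = (\<Sum>k<n. h a b k * flow (h i j) k)" by (rule flow_self_adjoint)
    also have "\<dots> = h a b i - h a b j"
      using i j by (simp add: flow_h right_diff_distrib sum_subtractf sum_mult_delta)
    finally have "h i j a - h i j b = h a b i - h a b j" .
    moreover have "h a b k \<le> h a b a" if "k < n" for k
      using a b that by (intro maximum_principle[of a]) (simp_all add: flow_h)
    moreover have "h a b b \<le> h a b k" if "k < n" for k
      using a b that by (intro minimum_principle[of b]) (simp_all add: flow_h)
    ultimately show ?thesis using i j unfolding r_def abs_le_iff by (smt (verit))
  qed
  have "(\<Sum>a<n. \<Sum>b<n. r a b)
      = (\<Sum>a<n. \<Sum>b<n. g a a + g b b) - (\<Sum>a<n. \<Sum>b<n. g b a) - (\<Sum>a<n. \<Sum>b<n. g a b)"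
    by (simp add: r_def h_def sum_subtractf sum.distrib algebra_simps)
  also have "(\<Sum>a<n. \<Sum>b<n. g b a) = (\<Sum>b<n. \<Sum>a<n. g b a)" by (rule sum.swap)
  also have "(\<Sum>a<n. \<Sum>b<n. g a a + g b b) = 2 * n * (\<Sum>a<n. g a a)"
    by (simp add: sum.distrib sum_distrib_left[symmetric])
  also have "(\<Sum>a<n. g a a) = 1 / n + (\<Sum>k = 2..n. 1 / ordered_eigenvalue laplacian k)"
    using trace_shifted_inverse[OF n X(1,2)] by (simp add: g_def)
  finally have total: "(\<Sum>a<n. \<Sum>b<n. r a b) = 2 * n * (\<Sum>k = 2..n. 1 / ordered_eigenvalue laplacian k)"
    using n mean by (simp add: algebra_simps)
  have sumI: "(\<Sum>k<n. I k) = 0" using sum_flow[of x] assms(1) by simp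
  have "(\<Sum>k<n. h i j k * I k) = (\<Sum>k<n. x k * flow (h i j) k)"
    using flow_self_adjoint[of "h i j" x] assms(1) by simp
  then have diff: "x i - x j = (\<Sum>k<n. h i j k * I k)"
    using i j by (simp add: flow_h right_diff_distrib sum_subtractf sum_mult_delta)
  \<comment> \<open>The mixed products, summed over all pairs, vanish because the currents sum to zero.\<close>
  have "(\<Sum>a<n. \<Sum>b<n. (h i j a - h i j b) * (I a - I b))
      = (\<Sum>a<n. \<Sum>b<n. h i j a * I a + h i j b * I b) - (\<Sum>a<n. \<Sum>b<n. h i j a * I b) - (\<Sum>a<n. \<Sum>b<n. h i j b * I a)"
    by (simp add: sum_subtractf sum.distrib algebra_simps)
  also have "\<dots> = 2 * n * (\<Sum>k<n. h i j k * I k)"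
    using sumI by (simp add: sum.distrib sum_distrib_left[symmetric] sum_distrib_right[symmetric])
  finally have "2 * n * \<bar>x i - x j\<bar> = \<bar>\<Sum>a<n. \<Sum>b<n. (h i j a - h i j b) * (I a - I b)\<bar>"
    by (simp add: diff abs_mult)
  also have "\<dots> \<le> (\<Sum>a<n. \<Sum>b<n. r a b * (2 * m))"
  proof (rule order_trans[OF sum_abs], rule sum_mono, rule order_trans[OF sum_abs], rule sum_mono)
    fix a b assume "a \<in> {..<n}" "b \<in> {..<n}"
    then have "\<bar>h i j a - h i j b\<bar> \<le> r a b" "\<bar>I a - I b\<bar> \<le> 2 * m"
      using resistance assms(2)[of a] assms(2)[of b] by auto
    then show "\<bar>(h i j a - h i j b) * (I a - I b)\<bar> \<le> r a b * (2 * m)"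
      unfolding abs_mult by (intro mult_mono) auto
  qed
  also have "\<dots> = 2 * n * (2 * m * (\<Sum>k = 2..n. 1 / ordered_eigenvalue laplacian k))"
    by (simp add: sum_distrib_right[symmetric] total)
  finally show ?thesis using n by simp
qed

section \<open>The optimal injections\<close>

lemma laplacian_mult_vec_iff:
  assumes "V \<in> carrier_vec n" "s \<in> carrier_vec n"
  shows "laplacian *\<^sub>v V = s \<longleftrightarrow> (\<forall>i<n. flow (\<lambda>k. V $ k) i = s $ i)"
proof -
  have "(laplacian *\<^sub>v V) $ i = flow (\<lambda>k. V $ k) i" if "i < n" for i
    using mat_mult_vec_entry[OF laplacian_carrier assms(1) that] laplacian_row_sum[OF that] by simp
  moreover have "laplacian *\<^sub>v V \<in> carrier_vec n" using laplacian_carrier assms(1) by (rule mult_mat_vec_carrier)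
  ultimately show ?thesis
    using assms(2) carrier_matD(1)[OF laplacian_carrier] by (auto simp: vec_eq_iff)
qed

text \<open>
  All feasible injections have the same total, since the flow sums to zero. If all marginal costs at
  \<open>us\<close> agree, the term of the cost that is linear in \<open>u - us\<close> therefore vanishes, and the excess cost is
  a positive definite quadratic form in \<open>u - us\<close>.
\<close>

lemma optimal_injection_iff:
  assumes I: "I \<in> carrier_vec n" and us: "us \<in> carrier_vec n" and Vs: "Vs \<in> carrier_vec n"
    and f: "\<And>i. i < n \<Longrightarrow> 0 < f i"
    and balance: "laplacian *\<^sub>v Vs = I + us"
    and marginal: "\<And>i. i < n \<Longrightarrow> f i * us $ i = \<alpha>"
  shows "(\<exists>V. optimal_injection n f laplacian I (u, V)) \<longleftrightarrow> u = us"
proof -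
  define cost where "cost u = (\<Sum>i<n. 1 / 2 * f i * (u $ i)\<^sup>2)" for u :: "real vec"
  let ?feasible = "\<lambda>u V. u \<in> carrier_vec n \<and> V \<in> carrier_vec n \<and> laplacian *\<^sub>v V = I + u"
  have total: "(\<Sum>i<n. u $ i) = - (\<Sum>i<n. I $ i)" if "?feasible u V" for u V
  proof -
    have "(\<Sum>i<n. I $ i + u $ i) = (\<Sum>i<n. flow (\<lambda>k. V $ k) i)"
      using that I laplacian_mult_vec_iff[of V "I + u"] by (intro sum.cong) auto
    then show ?thesis by (simp add: sum_flow sum.distrib)
  qed
  have excess: "cost u = cost us + (\<Sum>i<n. 1 / 2 * f i * (u $ i - us $ i)\<^sup>2)" if "?feasible u V" for u V
  proof -
    have "cost u = (\<Sum>i<n. 1 / 2 * f i * (us $ i)\<^sup>2 + \<alpha> * (u $ i - us $ i) + 1 / 2 * f i * (u $ i - us $ i)\<^sup>2)"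
      unfolding cost_def
    proof (rule sum.cong[OF refl])
      fix i assume "i \<in> {..<n}"
      then have "\<alpha> = f i * us $ i" using marginal by simp
      then show "1 / 2 * f i * (u $ i)\<^sup>2
          = 1 / 2 * f i * (us $ i)\<^sup>2 + \<alpha> * (u $ i - us $ i) + 1 / 2 * f i * (u $ i - us $ i)\<^sup>2"
        by (simp add: power2_eq_square field_simps)
    qed
    moreover have "(\<Sum>i<n. \<alpha> * (u $ i - us $ i)) = 0"
      using total[OF that] total[of us Vs] us Vs balance
      by (simp add: sum_distrib_left[symmetric] sum_subtractf)
    ultimately show ?thesis by (simp add: cost_def sum.distrib)
  qed
  have gap: "0 \<le> 1 / 2 * f i * (u $ i - us $ i)\<^sup>2" if "i < n" for u i
    using f[OF that] by simp
  have opt: "optimal_injection n f laplacian I (u, V)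
      \<longleftrightarrow> ?feasible u V \<and> \<not> (\<exists>u' V'. ?feasible u' V' \<and> cost u' < cost u)" for u V
    by (auto simp: optimal_injection_def is_arg_min_def cost_def)
  show ?thesis
  proof
    assume "\<exists>V. optimal_injection n f laplacian I (u, V)"
    then obtain V where V: "?feasible u V" and "\<not> cost us < cost u"
      using opt us Vs balance by blast
    then have "(\<Sum>i<n. 1 / 2 * f i * (u $ i - us $ i)\<^sup>2) \<le> 0" using excess[OF V] by simp
    then have "(\<Sum>i<n. 1 / 2 * f i * (u $ i - us $ i)\<^sup>2) = 0"
      using gap by (intro antisym sum_nonneg) auto
    then have vanish: "\<forall>i\<in>{..<n}. 1 / 2 * f i * (u $ i - us $ i)\<^sup>2 = 0"
      using gap by (subst (asm) sum_nonneg_eq_0_iff) auto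
    have "u $ i = us $ i" if "i < n" for i
    proof -
      have "1 / 2 * f i * (u $ i - us $ i)\<^sup>2 = 0" using vanish that by blast
      then show ?thesis using f[OF that] by simp
    qed
    then show "u = us" using V us by (intro eq_vecI) auto
  next
    assume "u = us"
    moreover have "cost us \<le> cost u'" if "?feasible u' V'" for u' V'
      using excess[OF that] sum_nonneg[of "{..<n}" "\<lambda>i. 1 / 2 * f i * (u' $ i - us $ i)\<^sup>2"] gap by auto
    ultimately show "\<exists>V. optimal_injection n f laplacian I (u, V)"
      using opt us Vs balance by (meson not_le)
  qed
qed

end

section \<open>Linear systems with a simple zero eigenvalue\<close>

text \<open>
  The complex case reduces to the monotonicity of a real function by projecting onto the direction of
  \<open>f b - f a\<close>.
\<close>

lemma norm_increment_le:
  fixes f :: "real \<Rightarrow> complex"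
  assumes "a \<le> b"
    and f: "\<And>t. a \<le> t \<Longrightarrow> t \<le> b \<Longrightarrow> (f has_vector_derivative f' t) (at t)"
    and \<phi>: "\<And>t. a \<le> t \<Longrightarrow> t \<le> b \<Longrightarrow> (\<phi> has_real_derivative \<phi>' t) (at t)"
    and le: "\<And>t. a \<le> t \<Longrightarrow> t \<le> b \<Longrightarrow> norm (f' t) \<le> \<phi>' t"
  shows "norm (f b - f a) \<le> \<phi> b - \<phi> a"
proof -
  define u where "u = cnj (sgn (f b - f a))"
  have u: "norm u \<le> 1" by (simp add: u_def norm_sgn)
  have "\<phi> a - Re (u * f a) \<le> \<phi> b - Re (u * f b)"
  proof (rule DERIV_nonneg_imp_nondecreasing[OF \<open>a \<le> b\<close>])
    fix t assume t: "a \<le> t" "t \<le> b"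
    have "((\<lambda>t. Re (u * f t)) has_vector_derivative Re (u * f' t)) (at t)"
      by (rule bounded_linear.has_vector_derivative[OF bounded_linear_compose[OF bounded_linear_Re bounded_linear_mult_right] f[OF t]])
    then have "((\<lambda>t. \<phi> t - Re (u * f t)) has_real_derivative \<phi>' t - Re (u * f' t)) (at t)"
      unfolding has_real_derivative_iff_has_vector_derivative[symmetric] by (intro DERIV_diff \<phi> t)
    moreover have "Re (u * f' t) \<le> norm u * norm (f' t)"
      by (metis complex_Re_le_cmod norm_mult)
    then have "Re (u * f' t) \<le> \<phi>' t"
      using le[OF t] mult_right_mono[OF u norm_ge_zero[of "f' t"]] by simp
    ultimately show "\<exists>y. ((\<lambda>t. \<phi> t - Re (u * f t)) has_real_derivative y) (at t) \<and> 0 \<le> y" by force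
  qed
  moreover have "u * d = of_real (norm d)" if "d = f b - f a" for d
  proof -
    have "u * d = d * cnj d / of_real (norm d)"
      by (simp add: u_def that sgn_div_norm scaleR_conv_of_real field_simps)
    then show ?thesis by (simp add: complex_norm_square[symmetric] power2_eq_square)
  qed
  then have "u * (f b - f a) = of_real (norm (f b - f a))" by blast
  then have "Re (u * f b) - Re (u * f a) = norm (f b - f a)"
    by (metis Re_complex_of_real minus_complex.sel(1) right_diff_distrib)
  ultimately show ?thesis by simp
qed

text \<open>
  After shifting \<open>g\<close> by its expected limit the forcing tends to zero. With the integrating factor
  \<open>exp (- \<mu> t)\<close> the forcing beyond a time \<open>T\<close> contributes at most its supremum divided by \<open>- Re \<mu>\<close>,
  and the influence of the state at time \<open>T\<close> decays exponentially.
\<close>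

lemma stable_scalar_limit:
  fixes g h :: "real \<Rightarrow> complex"
  assumes stable: "Re \<mu> < 0"
    and g: "\<And>t. 0 < t \<Longrightarrow> (g has_vector_derivative \<mu> * g t + h t) (at t)"
    and h: "(h \<longlongrightarrow> h0) at_top"
  shows "(g \<longlongrightarrow> - h0 / \<mu>) at_top"
proof -
  define a where "a = - Re \<mu>"
  have a: "0 < a" and \<mu>: "\<mu> \<noteq> 0" using stable by (auto simp: a_def)
  define G where "G t = g t + h0 / \<mu>" for t
  define F where "F t = exp (- \<mu> * of_real t) * G t" for t
  have norm_exp: "norm (exp (- \<mu> * of_real t)) = exp (a * t)" for t by (simp add: a_def norm_exp_eq_Re)
  have F: "(F has_vector_derivative exp (- \<mu> * of_real t) * (h t - h0)) (at t)" if "0 < t" for t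
  proof -
    have "((\<lambda>s. exp (- \<mu> * of_real s)) has_vector_derivative - \<mu> * exp (- \<mu> * of_real t)) (at t)"
      by (rule has_vector_derivative_real_field) (auto intro!: derivative_eq_intros)
    moreover have "(G has_vector_derivative \<mu> * g t + h t) (at t)"
      unfolding G_def using has_vector_derivative_add[OF g[OF that] has_vector_derivative_const] by simp
    ultimately have "(F has_vector_derivative
        exp (- \<mu> * of_real t) * (\<mu> * g t + h t) + - \<mu> * exp (- \<mu> * of_real t) * G t) (at t)"
      unfolding F_def by (rule has_vector_derivative_mult)
    moreover have "exp (- \<mu> * of_real t) * (\<mu> * g t + h t) + - \<mu> * exp (- \<mu> * of_real t) * G t
        = exp (- \<mu> * of_real t) * (h t - h0)"
      using \<mu> by (simp add: G_def algebra_simps)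
    ultimately show ?thesis by simp
  qed
  have "(G \<longlongrightarrow> 0) at_top"
    unfolding tendsto_iff
  proof (intro allI impI)
    fix e :: real assume e: "0 < e"
    \<comment> \<open>A forcing below this size contributes at most half of the tolerance.\<close>
    define \<epsilon> where "\<epsilon> = a * e / 2"
    have \<epsilon>: "0 < \<epsilon>" using a e by (simp add: \<epsilon>_def)
    obtain T0 where T0: "\<And>t. T0 \<le> t \<Longrightarrow> norm (h t - h0) < \<epsilon>"
      using tendstoD[OF h \<epsilon>] by (auto simp: eventually_at_top_linorder dist_norm)
    define T where "T = max T0 1"
    have bound: "norm (G t) \<le> exp (- (a * t)) * norm (F T) + e / 2" if t: "T \<le> t" for t
    proof -
      have "norm (F t - F T) \<le> \<epsilon> / a * exp (a * t) - \<epsilon> / a * exp (a * T)"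
      proof (rule norm_increment_le[OF t])
        fix s assume s: "T \<le> s" "s \<le> t"
        show "(F has_vector_derivative exp (- \<mu> * of_real s) * (h s - h0)) (at s)"
          using F s by (simp add: T_def)
        show "((\<lambda>s. \<epsilon> / a * exp (a * s)) has_real_derivative exp (a * s) * \<epsilon>) (at s)"
          using a by (auto intro!: derivative_eq_intros)
        show "norm (exp (- \<mu> * of_real s) * (h s - h0)) \<le> exp (a * s) * \<epsilon>"
          unfolding norm_mult norm_exp using T0[of s] s by (simp add: T_def)
      qed
      moreover have "0 \<le> \<epsilon> / a * exp (a * T)" using a \<epsilon> by simp
      ultimately have "norm (F t) \<le> norm (F T) + e / 2 * exp (a * t)"
        using norm_triangle_ineq2[of "F t" "F T"] a by (simp add: \<epsilon>_def)
      moreover have "norm (G t) = exp (- (a * t)) * norm (F t)"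
        unfolding F_def norm_mult norm_exp by (simp add: exp_minus)
      ultimately have "norm (G t) \<le> exp (- (a * t)) * (norm (F T) + e / 2 * exp (a * t))"
        by simp
      then show ?thesis by (simp add: exp_minus field_simps)
    qed
    have "((\<lambda>t. exp (- (a * t)) * norm (F T)) \<longlongrightarrow> 0) at_top"
    proof (rule tendsto_mult_left_zero, rule filterlim_compose[OF exp_at_bot])
      show "LIM t at_top. - (a * t) :> at_bot"
        using filterlim_tendsto_pos_mult_at_top[OF tendsto_const a filterlim_ident]
        by (simp add: filterlim_uminus_at_top)
    qed
    then have "\<forall>\<^sub>F t in at_top. exp (- (a * t)) * norm (F T) < e / 2"
      using e by (intro order_tendstoD) auto
    then show "\<forall>\<^sub>F t in at_top. dist (G t) 0 < e"
      using eventually_ge_at_top[of T] by eventually_elim (use bound in force)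
  qed
  from tendsto_add[OF this tendsto_const[of "- (h0 / \<mu>)"]] show ?thesis by (simp add: G_def)
qed

text \<open>
  The function solves \<open>f' = - f + (f + f')\<close>, a stable scalar equation whose forcing tends to \<open>L + d\<close>;
  hence \<open>L = L + d\<close>.
\<close>

lemma derivative_limit_eq_0:
  fixes f f' :: "real \<Rightarrow> real"
  assumes deriv: "\<And>t. 0 < t \<Longrightarrow> (f has_real_derivative f' t) (at t)"
    and f: "(f \<longlongrightarrow> L) at_top" and f': "(f' \<longlongrightarrow> d) at_top"
  shows "d = 0"
proof -
  have "((\<lambda>t. complex_of_real (f t)) \<longlongrightarrow> - complex_of_real (L + d) / (- 1)) at_top"
  proof (rule stable_scalar_limit)
    fix t :: real assume "0 < t"
    then have "((\<lambda>t. complex_of_real (f t)) has_vector_derivative complex_of_real (f' t)) (at t)"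
      using deriv by (simp add: has_real_derivative_iff_has_vector_derivative has_vector_derivative_of_real)
    then show "((\<lambda>t. complex_of_real (f t)) has_vector_derivative - 1 * complex_of_real (f t) + complex_of_real (f t + f' t)) (at t)"
      by simp
  qed (auto intro!: tendsto_intros f f')
  moreover have "((\<lambda>t. complex_of_real (f t)) \<longlongrightarrow> complex_of_real L) at_top"
    by (intro tendsto_of_real f)
  ultimately have "- complex_of_real (L + d) / (- 1) = complex_of_real L"
    by (rule tendsto_unique[OF trivial_limit_at_top_linorder])
  then show ?thesis by simp
qed

text \<open>
  Row \<open>i\<close> is a scalar equation forced by the later coordinates only, so convergence propagates from the
  last coordinate, which is constant in time, to the first.
\<close>

lemma triangular_system_converges:
  fixes T :: "complex mat" and z :: "nat \<Rightarrow> real \<Rightarrow> complex"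
  assumes T: "T \<in> carrier_mat N N" and tri: "upper_triangular T"
    and z: "\<And>i t. i < N \<Longrightarrow> 0 < t \<Longrightarrow> (z i has_vector_derivative (\<Sum>j<N. T $$ (i, j) * z j t) + \<beta> i) (at t)"
    and last: "T $$ (N - 1, N - 1) = 0" "\<beta> (N - 1) = 0"
    and stable: "\<And>i. i < N - 1 \<Longrightarrow> Re (T $$ (i, i)) < 0"
    and i: "i < N"
  shows "\<exists>l. (z i \<longlongrightarrow> l) at_top"
  using i
proof (induction "N - i" arbitrary: i rule: less_induct)
  case less
  define h where "h t = (\<Sum>j\<in>{i<..<N}. T $$ (i, j) * z j t) + \<beta> i" for t
  have deriv: "(z i has_vector_derivative T $$ (i, i) * z i t + h t) (at t)" if "0 < t" for t
  proof -
    have "(\<Sum>j<N. T $$ (i, j) * z j t) = (\<Sum>j\<in>insert i {i<..<N}. T $$ (i, j) * z j t)"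
      using less.prems T upper_triangularD[OF tri, of _ i]
      by (intro sum.mono_neutral_right) (auto simp: not_less_iff_gr_or_eq)
    then have "(\<Sum>j<N. T $$ (i, j) * z j t) + \<beta> i = T $$ (i, i) * z i t + h t"
      by (simp add: h_def)
    then show ?thesis using z[OF less.prems that] by simp
  qed
  have "\<exists>l. (z j \<longlongrightarrow> l) at_top" if "j \<in> {i<..<N}" for j
    using less.hyps[of j] less.prems that by (simp add: diff_less_mono2)
  then obtain l where l: "\<forall>j\<in>{i<..<N}. (z j \<longlongrightarrow> l j) at_top"
    using bchoice[of "{i<..<N}" "\<lambda>j l. (z j \<longlongrightarrow> l) at_top"] by blast
  have h: "(h \<longlongrightarrow> (\<Sum>j\<in>{i<..<N}. T $$ (i, j) * l j) + \<beta> i) at_top"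
    unfolding h_def using l by (intro tendsto_add tendsto_sum tendsto_mult tendsto_const) blast+
  show ?case
  proof (cases "i < N - 1")
    case True
    then show ?thesis using stable_scalar_limit[OF stable deriv h] by blast
  next
    case False
    then have iN: "i = N - 1" "{i<..<N} = {}" using less.prems by auto
    then have "(z i has_vector_derivative 0) (at t)" if "0 < t" for t
      using deriv[OF that] last by (simp add: h_def)
    then have const: "z i t = z i 1" if "1 \<le> t" for t
      using norm_increment_le[OF that, of "z i" "\<lambda>_. 0" "\<lambda>_. 0" "\<lambda>_. 0"] by auto
    have "(z i \<longlongrightarrow> z i 1) at_top"
      by (rule tendsto_eventually, rule eventually_mono[OF eventually_ge_at_top[of 1] const])
    then show ?thesis ..
  qed
qed

lemma real_kernel_spans_complex_kernel:
  fixes M :: "nat \<Rightarrow> nat \<Rightarrow> real" and v :: "nat \<Rightarrow> real" and y :: "nat \<Rightarrow> complex"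
  assumes ker: "\<And>x. (\<And>i. i < N \<Longrightarrow> (\<Sum>j<N. M i j * x j) = 0) \<Longrightarrow> \<exists>\<kappa>. \<forall>j<N. x j = \<kappa> * v j"
    and y: "\<And>i. i < N \<Longrightarrow> (\<Sum>j<N. of_real (M i j) * y j) = 0"
  shows "\<exists>\<kappa>. \<forall>j<N. y j = \<kappa> * of_real (v j)"
proof -
  have "\<exists>\<kappa>. \<forall>j<N. Re (y j) = \<kappa> * v j"
    by (rule ker) (use arg_cong[OF y, of _ Re] in simp)
  moreover have "\<exists>\<kappa>. \<forall>j<N. Im (y j) = \<kappa> * v j"
    by (rule ker) (use arg_cong[OF y, of _ Im] in simp)
  ultimately obtain a b where "\<forall>j<N. Re (y j) = a * v j" "\<forall>j<N. Im (y j) = b * v j"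
    by blast
  then have "\<forall>j<N. y j = Complex a b * of_real (v j)" by (simp add: complex_eq_iff)
  then show ?thesis ..
qed

text \<open>
  Real vectors spanning the right and the left kernel, with nonzero pairing: together these say that
  zero is an algebraically simple eigenvalue.
\<close>

locale simple_kernel =
  fixes N :: nat and A :: "real mat" and v w :: "nat \<Rightarrow> real"
  assumes A: "A \<in> carrier_mat N N"
    and kernel_v: "\<And>i. i < N \<Longrightarrow> (\<Sum>j<N. A $$ (i, j) * v j) = 0"
    and right_kernel: "\<And>x. (\<And>i. i < N \<Longrightarrow> (\<Sum>j<N. A $$ (i, j) * x j) = 0) \<Longrightarrow> \<exists>\<kappa>. \<forall>j<N. x j = \<kappa> * v j"
    and left_kernel: "\<And>y. (\<And>j. j < N \<Longrightarrow> (\<Sum>i<N. A $$ (i, j) * y i) = 0) \<Longrightarrow> \<exists>\<kappa>. \<forall>i<N. y i = \<kappa> * w i"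
    and pairing: "(\<Sum>i<N. w i * v i) \<noteq> 0"
begin

abbreviation A\<^sub>C :: "complex mat" where
  "A\<^sub>C \<equiv> map_mat complex_of_real A"

lemma AC: "A\<^sub>C \<in> carrier_mat N N" using A by simp

lemma N_pos: "0 < N" using pairing by (cases N) auto

lemma last_row_left_eigenvector:
  assumes car: "T \<in> carrier_mat N N" "Q \<in> carrier_mat N N" and QA: "Q * A\<^sub>C = T * Q"
    and tri: "upper_triangular T" and T: "T $$ (N - 1, N - 1) = 0"
  shows "\<exists>\<kappa>. \<forall>i<N. Q $$ (N - 1, i) = \<kappa> * of_real (w i)"
proof (rule real_kernel_spans_complex_kernel[where M = "\<lambda>j i. A $$ (i, j)"])
  fix j assume j: "j < N"
  have "(\<Sum>i<N. of_real (A $$ (i, j)) * Q $$ (N - 1, i)) = (Q * A\<^sub>C) $$ (N - 1, j)"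
    using A N_pos j by (simp add: mat_mult_entry[OF car(2) AC] mult.commute del: index_mult_mat)
  also have "\<dots> = (\<Sum>k<N. T $$ (N - 1, k) * Q $$ (k, j))"
    using N_pos j by (simp add: QA mat_mult_entry[OF car] del: index_mult_mat)
  also have "\<dots> = 0"
  proof (rule sum.neutral, safe)
    fix k assume "k < N"
    then show "T $$ (N - 1, k) * Q $$ (k, j) = 0"
      using upper_triangularD[OF tri, of k "N - 1"] car T by (cases "k = N - 1") auto
  qed
  finally show "(\<Sum>i<N. of_real (A $$ (i, j)) * Q $$ (N - 1, i)) = 0" .
qed (rule left_kernel)

lemma first_column_right_eigenvector:
  assumes car: "P \<in> carrier_mat N N" "T \<in> carrier_mat N N" and AP: "A\<^sub>C * P = P * T"
    and tri: "upper_triangular T" and T: "T $$ (0, 0) = 0"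
  shows "\<exists>\<kappa>. \<forall>i<N. P $$ (i, 0) = \<kappa> * of_real (v i)"
proof (rule real_kernel_spans_complex_kernel[where M = "\<lambda>i j. A $$ (i, j)"])
  fix i assume i: "i < N"
  have "(\<Sum>j<N. of_real (A $$ (i, j)) * P $$ (j, 0)) = (A\<^sub>C * P) $$ (i, 0)"
    using A N_pos i by (simp add: mat_mult_entry[OF AC car(1)] del: index_mult_mat)
  also have "\<dots> = (\<Sum>k<N. P $$ (i, k) * T $$ (k, 0))"
    using N_pos i by (simp add: AP mat_mult_entry[OF car] del: index_mult_mat)
  also have "\<dots> = 0"
  proof (rule sum.neutral, safe)
    fix k assume "k < N"
    then show "P $$ (i, k) * T $$ (k, 0) = 0"
      using upper_triangularD[OF tri, of 0 k] car T by (cases "k = 0") auto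
  qed
  finally show "(\<Sum>j<N. of_real (A $$ (i, j)) * P $$ (j, 0)) = 0" .
qed (rule right_kernel)

lemma char_poly_reordered:
  assumes "mset es = eigenvalue_mset A\<^sub>C"
  shows "char_poly A\<^sub>C = (\<Prod>e\<leftarrow>es. [:- e, 1:])"
proof -
  obtain zs where zs: "char_poly A\<^sub>C = (\<Prod>z\<leftarrow>zs. [:- z, 1:])"
    using char_poly_factorized[OF AC] by blast
  then have "mset zs = mset es" using assms by (simp add: eigenvalue_mset_def proots_linear_factors)
  then have "mset (map (\<lambda>e. [:- e, 1:]) zs) = mset (map (\<lambda>e. [:- e, 1:]) es)" by simp
  from arg_cong[OF this, of prod_mset] show ?thesis unfolding zs by (simp only: prod_mset_prod_list)
qed

lemma zero_in_spectrum: "0 \<in># eigenvalue_mset A\<^sub>C"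
proof -
  obtain i where i: "i < N" "v i \<noteq> 0" 
    using pairing sum.neutral[of "{..<N}" "\<lambda>i. w i * v i"] by auto
  let ?v = "vec N (\<lambda>i. complex_of_real (v i))"
  have "eigenvector A\<^sub>C ?v 0"
    unfolding eigenvector_def
  proof (intro conjI)
    show "?v \<noteq> 0\<^sub>v (dim_row A\<^sub>C)" using i A by (auto dest!: arg_cong[where f = "\<lambda>x. x $ i"])
    show "A\<^sub>C *\<^sub>v ?v = 0 \<cdot>\<^sub>v ?v"
    proof (rule eq_vecI)
      fix i assume "i < dim_vec (0 \<cdot>\<^sub>v ?v)"
      then have i: "i < N" by simp
      have "(A\<^sub>C *\<^sub>v ?v) $ i = complex_of_real (\<Sum>j<N. A $$ (i, j) * v j)"
        using A i by (simp add: mat_mult_vec_entry[OF AC _ i] del: index_mult_mat_vec)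
      then show "(A\<^sub>C *\<^sub>v ?v) $ i = (0 \<cdot>\<^sub>v ?v) $ i" using i kernel_v by simp
    qed (use A in simp)
  qed (use A in auto)
  then have "poly (char_poly A\<^sub>C) 0 = 0"
    using eigenvalue_root_char_poly[OF AC] by (auto simp: eigenvalue_def)
  moreover have "char_poly A\<^sub>C \<noteq> 0"
    using char_poly_factorized[OF AC] by (auto simp: prod_list_zero_iff)
  ultimately show ?thesis by (simp add: eigenvalue_mset_def)
qed

text \<open>
  If zero had multiplicity at least two, it could be placed both first and last on the diagonal of a
  Schur form. Then the first column of \<open>P\<close> is a multiple of \<open>v\<close> and the last row of \<open>Q\<close> a multiple of
  \<open>w\<close>; they are orthogonal because \<open>Q P = 1\<close>, against the nonzero pairing.
\<close>

lemma zero_eigenvalue_simple: "count (eigenvalue_mset A\<^sub>C) 0 = 1"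
proof (rule ccontr)
  assume "count (eigenvalue_mset A\<^sub>C) 0 \<noteq> 1"
  moreover have "count (eigenvalue_mset A\<^sub>C) 0 \<noteq> 0" using zero_in_spectrum by simp
  ultimately have "2 \<le> count (eigenvalue_mset A\<^sub>C) 0" by linarith
  then have "replicate_mset 2 0 \<subseteq># eigenvalue_mset A\<^sub>C"
    by (simp only: count_le_replicate_mset_subset_eq)
  then obtain M' where "eigenvalue_mset A\<^sub>C = replicate_mset 2 0 + M'"
    by (rule mset_subset_eq_exists_conv[THEN iffD1, THEN exE])
  then have M': "eigenvalue_mset A\<^sub>C = {#0, 0#} + M'" by (simp add: numeral_2_eq_2)
  obtain es where es: "mset es = M'" using ex_mset by blast
  have spec: "mset (0 # es @ [0]) = eigenvalue_mset A\<^sub>C" using es M' by simp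
  obtain P T Q where car: "P \<in> carrier_mat N N" "T \<in> carrier_mat N N" "Q \<in> carrier_mat N N"
    and "P * Q = 1\<^sub>m N" and QP: "Q * P = 1\<^sub>m N" and eig: "A\<^sub>C * P = P * T" "Q * A\<^sub>C = T * Q"
    and tri: "upper_triangular T" and diag: "\<forall>i<N. T $$ (i, i) = (0 # es @ [0]) ! i"
    and len: "length (0 # es @ [0]) = N"
    by (rule schur_form[OF AC char_poly_reordered[OF spec]])
  have N: "N - 1 = Suc (length es)" "0 < N" using len by auto
  have T: "T $$ (0, 0) = 0" "T $$ (N - 1, N - 1) = 0"
    using diag[rule_format, of 0] diag[rule_format, of "N - 1"] N by (simp_all add: nth_append)
  obtain a where a: "\<And>i. i < N \<Longrightarrow> P $$ (i, 0) = a * of_real (v i)"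
    using first_column_right_eigenvector[OF car(1,2) eig(1) tri T(1)] by blast
  obtain b where b: "\<And>i. i < N \<Longrightarrow> Q $$ (N - 1, i) = b * of_real (w i)"
    using last_row_left_eigenvector[OF car(2,3) eig(2) tri T(2)] by blast
  have entry: "(\<Sum>k<N. Q $$ (i, k) * P $$ (k, j)) = (if i = j then 1 else 0)" if "i < N" "j < N" for i j
    using mat_mult_entry[OF car(3,1) that] that QP by simp
  have "a \<noteq> 0" using entry[of 0 0] N a by auto
  moreover have "b \<noteq> 0" using entry[of "N - 1" "N - 1"] N b by auto
  moreover have "(\<Sum>k<N. b * of_real (w k) * (a * of_real (v k))) = 0"
    using entry[of "N - 1" 0] N a b by simp
  then have "b * a * of_real (\<Sum>k<N. w k * v k) = 0"
    by (simp add: sum_distrib_left mult_ac)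
  ultimately show False using pairing by (simp del: of_real_sum)
qed

text \<open>
  In Schur coordinates with the zero eigenvalue last, the last coordinate is a multiple of the pairing
  of \<open>w\<close> with the state; its derivative is the corresponding multiple of the pairing of \<open>w\<close> with \<open>b\<close>,
  which is zero.
\<close>

lemma solution_converges:
  assumes stable: "\<And>z. z \<in># eigenvalue_mset A\<^sub>C - {#0#} \<Longrightarrow> Re z < 0"
    and b: "(\<Sum>i<N. w i * b i) = 0"
    and x: "\<And>i t. i < N \<Longrightarrow> 0 < t \<Longrightarrow> (x i has_real_derivative (\<Sum>j<N. A $$ (i, j) * x j t) + b i) (at t)"
    and i: "i < N"
  shows "\<exists>l. (x i \<longlongrightarrow> l) at_top"
proof -
  obtain es where es: "mset es = eigenvalue_mset A\<^sub>C - {#0#}" using ex_mset by blast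
  then have spec: "mset (es @ [0]) = eigenvalue_mset A\<^sub>C" using zero_in_spectrum by simp
  obtain P T Q where car: "P \<in> carrier_mat N N" "T \<in> carrier_mat N N" "Q \<in> carrier_mat N N"
    and PQ: "P * Q = 1\<^sub>m N" and "Q * P = 1\<^sub>m N" and "A\<^sub>C * P = P * T" and QA: "Q * A\<^sub>C = T * Q"
    and tri: "upper_triangular T" and diag: "\<forall>i<N. T $$ (i, i) = (es @ [0]) ! i"
    and len: "length (es @ [0]) = N"
    by (rule schur_form[OF AC char_poly_reordered[OF spec]])
  have N: "N - 1 = length es" using len by auto
  have T: "T $$ (N - 1, N - 1) = 0" using diag[rule_format, of "N - 1"] N N_pos by simp
  define z where "z k t = (\<Sum>j<N. Q $$ (k, j) * of_real (x j t))" for k t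
  define \<beta> where "\<beta> k = (\<Sum>j<N. Q $$ (k, j) * of_real (b j))" for k
  have "\<exists>l. (z k \<longlongrightarrow> l) at_top" if k: "k < N" for k
  proof (rule triangular_system_converges[OF car(2) tri _ T _ _ k])
    obtain c where "\<And>i. i < N \<Longrightarrow> Q $$ (N - 1, i) = c * of_real (w i)"
      using last_row_left_eigenvector[OF car(2,3) QA tri T] by blast
    then have "\<beta> (N - 1) = c * of_real (\<Sum>i<N. w i * b i)"
      by (simp add: \<beta>_def sum_distrib_left mult_ac)
    then show "\<beta> (N - 1) = 0" using b by simp
  next
    fix k assume "k < N - 1"
    then have "T $$ (k, k) \<in> set es" using diag[rule_format, of k] N by (simp add: nth_append)
    then show "Re (T $$ (k, k)) < 0" using stable es by (metis set_mset_mset)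
  next
    fix k :: nat and t :: real assume k: "k < N" and t: "0 < t"
    have "(z k has_vector_derivative (\<Sum>j<N. Q $$ (k, j) * of_real ((\<Sum>m<N. A $$ (j, m) * x m t) + b j))) (at t)"
      unfolding z_def
    proof (intro has_vector_derivative_sum has_vector_derivative_mult_right)
      fix j assume "j \<in> {..<N}"
      then show "((\<lambda>t. complex_of_real (x j t)) has_vector_derivative
          complex_of_real ((\<Sum>m<N. A $$ (j, m) * x m t) + b j)) (at t)"
        by (intro has_vector_derivative_of_real x[OF _ t]) simp
    qed
    also have "(\<Sum>j<N. Q $$ (k, j) * of_real ((\<Sum>m<N. A $$ (j, m) * x m t) + b j))
        = (\<Sum>j<N. \<Sum>m<N. Q $$ (k, j) * of_real (A $$ (j, m)) * of_real (x m t)) + \<beta> k"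
      by (simp add: \<beta>_def distrib_left sum.distrib sum_distrib_left mult.assoc)
    also have "(\<Sum>j<N. \<Sum>m<N. Q $$ (k, j) * of_real (A $$ (j, m)) * of_real (x m t))
        = (\<Sum>m<N. (Q * A\<^sub>C) $$ (k, m) * of_real (x m t))"
      using A k by (subst sum.swap) (simp add: mat_mult_entry[OF car(3) AC] sum_distrib_right del: index_mult_mat)
    also have "\<dots> = (\<Sum>m<N. \<Sum>j<N. T $$ (k, j) * (Q $$ (j, m) * of_real (x m t)))"
      using k by (simp add: QA mat_mult_entry[OF car(2,3)] sum_distrib_right mult.assoc del: index_mult_mat)
    also have "\<dots> = (\<Sum>j<N. T $$ (k, j) * z j t)"
      by (subst sum.swap) (simp add: z_def sum_distrib_left)
    finally show "(z k has_vector_derivative (\<Sum>j<N. T $$ (k, j) * z j t) + \<beta> k) (at t)" .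
  qed
  then obtain l where l: "\<And>k. k < N \<Longrightarrow> (z k \<longlongrightarrow> l k) at_top" by metis
  have "of_real (x i t) = (\<Sum>k<N. P $$ (i, k) * z k t)" for t
  proof -
    have "(\<Sum>k<N. P $$ (i, k) * z k t) = (\<Sum>j<N. \<Sum>k<N. P $$ (i, k) * Q $$ (k, j) * of_real (x j t))"
      unfolding z_def sum_distrib_left by (subst sum.swap) (simp add: mult.assoc)
    also have "\<dots> = (\<Sum>j<N. (P * Q) $$ (i, j) * of_real (x j t))"
      using i by (simp add: mat_mult_entry[OF car(1,3)] sum_distrib_right del: index_mult_mat)
    also have "\<dots> = (\<Sum>j<N. if j = i then of_real (x j t) else 0)"
      using i by (intro sum.cong) (auto simp: PQ)
    finally show ?thesis using i by simp
  qed
  moreover have "((\<lambda>t. \<Sum>k<N. P $$ (i, k) * z k t) \<longlongrightarrow> (\<Sum>k<N. P $$ (i, k) * l k)) at_top"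
    using l by (intro tendsto_sum tendsto_mult tendsto_const) blast
  ultimately have "((\<lambda>t. complex_of_real (x i t)) \<longlongrightarrow> (\<Sum>k<N. P $$ (i, k) * l k)) at_top" by simp
  from tendsto_Re[OF this] show ?thesis by auto
qed

end

section \<open>The closed-loop matrix\<close>

lemma sum_blocks: "(\<Sum>j<m * n. g j) = (\<Sum>q<m. \<Sum>k<n. g (q * n + k))" for m n :: nat
proof -
  have "(\<Sum>k<n. g (q * n + k)) = sum g {q * n..<q * n + n}" for q
    using sum.shift_bounds_nat_ivl[of g 0 "q * n" n] by (simp add: lessThan_atLeast0 add.commute)
  then show ?thesis using sum.nat_group[of g n m] by simp
qed

lemma block_matrix_entry:
  assumes "p < length Bs" "q < length Bs" "i < n" "k < n"
  shows "block_matrix n Bs $$ (p * n + i, q * n + k) = Bs ! p ! q $$ (i, k)"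
proof -
  have "r * n + j < length Bs * n" if "r < length Bs" "j < n" for r j
    using that mult_le_mono1[of "Suc r" "length Bs" n] by simp
  then show ?thesis using assms by (simp add: block_matrix_def)
qed

lemma block_matrix_row_sum:
  assumes "p < length Bs" "i < n"
  shows "(\<Sum>j<length Bs * n. block_matrix n Bs $$ (p * n + i, j) * x j)
       = (\<Sum>q<length Bs. \<Sum>k<n. Bs ! p ! q $$ (i, k) * x (q * n + k))"
  using assms by (simp add: sum_blocks block_matrix_entry)

lemma block_matrix_col_sum:
  assumes "q < length Bs" "k < n"
  shows "(\<Sum>i<length Bs * n. block_matrix n Bs $$ (i, q * n + k) * x i)
       = (\<Sum>p<length Bs. \<Sum>i<n. Bs ! p ! q $$ (i, k) * x (p * n + i))"
  using assms by (simp add: sum_blocks block_matrix_entry)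

text \<open>
  Block vectors as functions on indices, with block \<open>q\<close> at offset \<open>q n\<close>, the layout of
  \<open>block_matrix\<close>.
\<close>

definition stack :: "nat \<Rightarrow> (nat \<Rightarrow> 'a) \<Rightarrow> (nat \<Rightarrow> 'a) \<Rightarrow> (nat \<Rightarrow> 'a) \<Rightarrow> nat \<Rightarrow> 'a" where
  "stack n a b c j = (if j < n then a j else if j < 2 * n then b (j - n) else c (j - 2 * n))"

lemma stack_simps:
  assumes "k < n"
  shows "stack n a b c k = a k" "stack n a b c (n + k) = b k" "stack n a b c (2 * n + k) = c k"
  using assms by (simp_all add: stack_def)

lemma sum_three_blocks: "(\<Sum>j<3 * n. g j) = (\<Sum>k<n. g k) + (\<Sum>k<n. g (n + k)) + (\<Sum>k<n. g (2 * n + k))" for n :: nat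
  using sum_blocks[of g 3 n] by (simp add: numeral_3_eq_3 numeral_2_eq_2)

lemma three_blocks_cases:
  fixes n :: nat
  assumes "j < 3 * n"
  obtains k where "k < n" "j = k" | k where "k < n" "j = n + k" | k where "k < n" "j = 2 * n + k"
proof -
  consider "j < n" | "n \<le> j" "j < 2 * n" | "2 * n \<le> j" by linarith
  then show ?thesis
  proof cases
    case 1 then show ?thesis using that(1) by blast
  next
    case 2 then show ?thesis using that(2)[of "j - n"] by simp
  next
    case 3 then show ?thesis using that(3)[of "j - 2 * n"] assms by simp
  qed
qed

locale closed_loop =
  grid: connected_network n EL "\<lambda>i j. 1 / R i j" + comm: connected_network n EC c
  for n :: nat and EL EC :: "nat rel" and R c :: "nat \<Rightarrow> nat \<Rightarrow> real" +
  fixes cap KP KV :: "nat \<Rightarrow> real" and \<gamma> \<delta> :: real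
  assumes n_pos: "0 < n"
    and cap_pos: "\<And>i. i < n \<Longrightarrow> 0 < cap i"
    and KP_pos: "\<And>i. i < n \<Longrightarrow> 0 < KP i"
    and KV_pos: "\<And>i. i < n \<Longrightarrow> 0 < KV i"
    and \<gamma>_pos: "0 < \<gamma>" and \<delta>_pos: "0 < \<delta>"
begin

abbreviation A :: "real mat" where
  "A \<equiv> closed_loop_matrix n \<gamma> \<delta> grid.laplacian comm.laplacian
     (capacity_matrix n cap) (mat_diag n KP) (mat_diag n KV)"

lemma A_carrier: "A \<in> carrier_mat (3 * n) (3 * n)"
  by (rule carrier_matI) (simp_all add: closed_loop_matrix_def block_matrix_def)

lemma diag_sum:
  assumes "i < n"
  shows "(\<Sum>k<n. mat_diag n d $$ (i, k) * y k) = d i * y i"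
    and "(\<Sum>k<n. mat_diag n d $$ (k, i) * y k) = d i * (y i :: real)"
proof -
  have "(\<Sum>k<n. mat_diag n d $$ (i, k) * y k) = (\<Sum>k<n. if k = i then d i * y i else 0)"
    by (rule sum.cong[OF refl]) (use assms in \<open>auto simp: mat_diag_def\<close>)
  also have "\<dots> = d i * y i" using assms by simp
  finally show "(\<Sum>k<n. mat_diag n d $$ (i, k) * y k) = d i * y i" .
  have "(\<Sum>k<n. mat_diag n d $$ (k, i) * y k) = (\<Sum>k<n. if k = i then d i * y i else 0)"
    by (rule sum.cong[OF refl]) (use assms in \<open>auto simp: mat_diag_def\<close>)
  also have "\<dots> = d i * y i" using assms by simp
  finally show "(\<Sum>k<n. mat_diag n d $$ (k, i) * y k) = d i * y i" .
qed

lemma capacity_times_KP: "capacity_matrix n cap * mat_diag n KP = mat_diag n (\<lambda>i. KP i / cap i)"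
  by (simp add: capacity_matrix_def divide_inverse mult.commute)

lemma voltage_block:
  assumes "i < n" "k < n"
  shows "(capacity_matrix n cap * (grid.laplacian + mat_diag n KP)) $$ (i, k)
       = grid.laplacian $$ (i, k) / cap i + mat_diag n (\<lambda>i. KP i / cap i) $$ (i, k)"
  using assms
  by (subst capacity_matrix_def, subst mat_diag_mult_left[of _ n n])
    (auto simp: mat_diag_def divide_inverse algebra_simps)

lemma laplacian_block_sums:
  assumes "i < n"
  shows "(\<Sum>k<n. (a \<cdot>\<^sub>m comm.laplacian) $$ (i, k) * y k) = a * comm.flow y i"
    and "(\<Sum>k<n. (a \<cdot>\<^sub>m comm.laplacian) $$ (k, i) * y k) = a * comm.flow y i"
proof -
  note dims = carrier_matD[OF comm.laplacian_carrier]
  have "(\<Sum>k<n. (a \<cdot>\<^sub>m comm.laplacian) $$ (i, k) * y k) = a * (\<Sum>k<n. comm.laplacian $$ (i, k) * y k)"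
    unfolding sum_distrib_left using assms dims by (intro sum.cong) auto
  then show "(\<Sum>k<n. (a \<cdot>\<^sub>m comm.laplacian) $$ (i, k) * y k) = a * comm.flow y i"
    unfolding comm.laplacian_row_sum[OF assms] .
  have "(\<Sum>k<n. (a \<cdot>\<^sub>m comm.laplacian) $$ (k, i) * y k) = a * (\<Sum>k<n. y k * comm.laplacian $$ (k, i))"
    unfolding sum_distrib_left using assms dims by (intro sum.cong) auto
  then show "(\<Sum>k<n. (a \<cdot>\<^sub>m comm.laplacian) $$ (k, i) * y k) = a * comm.flow y i"
    unfolding comm.laplacian_col_sum[OF assms] .
qed

lemma voltage_block_sums:
  assumes "i < n"
  shows "(\<Sum>k<n. (- (capacity_matrix n cap * (grid.laplacian + mat_diag n KP))) $$ (i, k) * y k)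
       = - (grid.flow y i + KP i * y i) / cap i"
    and "(\<Sum>k<n. (- (capacity_matrix n cap * (grid.laplacian + mat_diag n KP))) $$ (k, i) * y k)
       = - (grid.flow (\<lambda>k. y k / cap k) i + KP i * (y i / cap i))"
proof -
  have dims: "dim_row (capacity_matrix n cap * (grid.laplacian + mat_diag n KP)) = n"
    "dim_col (capacity_matrix n cap * (grid.laplacian + mat_diag n KP)) = n"
    by (simp_all add: capacity_matrix_def mat_diag_def)
  have "(\<Sum>k<n. (- (capacity_matrix n cap * (grid.laplacian + mat_diag n KP))) $$ (i, k) * y k)
      = (\<Sum>k<n. - (grid.laplacian $$ (i, k) * y k / cap i) - mat_diag n (\<lambda>i. KP i / cap i) $$ (i, k) * y k)"
    by (rule sum.cong[OF refl]) (use assms dims in \<open>simp add: voltage_block algebra_simps del: index_mult_mat(1)\<close>)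
  also have "\<dots> = - (\<Sum>k<n. grid.laplacian $$ (i, k) * y k) / cap i
      - (\<Sum>k<n. mat_diag n (\<lambda>i. KP i / cap i) $$ (i, k) * y k)"
    by (simp add: sum_subtractf sum_negf sum_divide_distrib)
  finally show "(\<Sum>k<n. (- (capacity_matrix n cap * (grid.laplacian + mat_diag n KP))) $$ (i, k) * y k)
       = - (grid.flow y i + KP i * y i) / cap i"
    using assms by (simp add: grid.laplacian_row_sum diag_sum diff_divide_distrib)
  have "(\<Sum>k<n. (- (capacity_matrix n cap * (grid.laplacian + mat_diag n KP))) $$ (k, i) * y k)
      = (\<Sum>k<n. - (y k / cap k * grid.laplacian $$ (k, i)) - mat_diag n (\<lambda>i. KP i / cap i) $$ (k, i) * y k)"
    by (rule sum.cong[OF refl]) (use assms dims in \<open>simp add: voltage_block algebra_simps del: index_mult_mat(1)\<close>)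
  also have "\<dots> = - (\<Sum>k<n. y k / cap k * grid.laplacian $$ (k, i))
      - (\<Sum>k<n. mat_diag n (\<lambda>i. KP i / cap i) $$ (k, i) * y k)"
    by (simp add: sum_subtractf sum_negf)
  finally show "(\<Sum>k<n. (- (capacity_matrix n cap * (grid.laplacian + mat_diag n KP))) $$ (k, i) * y k)
       = - (grid.flow (\<lambda>k. y k / cap k) i + KP i * (y i / cap i))"
    unfolding grid.laplacian_col_sum[OF assms] diag_sum(2)[OF assms] by simp
qed

lemma zero_block_sums:
  assumes "i < n"
  shows "(\<Sum>k<n. 0\<^sub>m n n $$ (i, k) * y k) = (0 :: real)" "(\<Sum>k<n. 0\<^sub>m n n $$ (k, i) * y k) = (0 :: real)"
  using assms by simp_all

lemma uminus_diag: "- mat_diag n d = mat_diag n (\<lambda>i. - d i :: real)"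
  by (rule eq_matI) (auto simp: mat_diag_def)

definition blocks :: "real mat list list" where
  "blocks =
    [[(- \<delta>) \<cdot>\<^sub>m comm.laplacian, 0\<^sub>m n n, - mat_diag n KV],
     [(- \<gamma>) \<cdot>\<^sub>m comm.laplacian, (- \<gamma>) \<cdot>\<^sub>m comm.laplacian, \<gamma> \<cdot>\<^sub>m comm.laplacian],
     [capacity_matrix n cap * mat_diag n KP, capacity_matrix n cap * mat_diag n KP,
      - (capacity_matrix n cap * (grid.laplacian + mat_diag n KP))]]"

lemma A_blocks: "A = block_matrix n blocks"
  by (simp add: closed_loop_matrix_def blocks_def)

lemma length_blocks: "length blocks = 3"
  by (simp add: blocks_def)

lemma A_row_sums:
  assumes i: "i < n"
  shows "(\<Sum>j<3 * n. A $$ (i, j) * x j) = - \<delta> * comm.flow x i - KV i * x (2 * n + i)"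
    and "(\<Sum>j<3 * n. A $$ (n + i, j) * x j) = - \<gamma> * comm.flow (\<lambda>k. x k + x (n + k) - x (2 * n + k)) i"
    and "(\<Sum>j<3 * n. A $$ (2 * n + i, j) * x j)
      = (KP i * (x i + x (n + i) - x (2 * n + i)) - grid.flow (\<lambda>k. x (2 * n + k)) i) / cap i"
proof -
  have split: "comm.flow (\<lambda>k. x k + x (n + k) - x (2 * n + k)) i
      = comm.flow x i + comm.flow (\<lambda>k. x (n + k)) i - comm.flow (\<lambda>k. x (2 * n + k)) i"
    using comm.flow_diff[of x "\<lambda>k. x (2 * n + k) - x (n + k)" i]
      comm.flow_diff[of "\<lambda>k. x (2 * n + k)" "\<lambda>k. x (n + k)" i] by (simp add: algebra_simps)
  note sums = laplacian_block_sums[OF i] voltage_block_sums[OF i] zero_block_sums[OF i] diag_sum[OF i]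
    capacity_times_KP uminus_diag
  have row: "(\<Sum>j<3 * n. A $$ (p * n + i, j) * x j) = (\<Sum>k<n. blocks ! p ! 0 $$ (i, k) * x k)
      + (\<Sum>k<n. blocks ! p ! 1 $$ (i, k) * x (n + k)) + (\<Sum>k<n. blocks ! p ! 2 $$ (i, k) * x (2 * n + k))"
    if "p < 3" for p
    using block_matrix_row_sum[of p blocks i n x] that i
    by (simp add: A_blocks length_blocks numeral_3_eq_3 numeral_2_eq_2)
  show "(\<Sum>j<3 * n. A $$ (i, j) * x j) = - \<delta> * comm.flow x i - KV i * x (2 * n + i)"
    using row[of 0] by (simp add: blocks_def sums)
  show "(\<Sum>j<3 * n. A $$ (n + i, j) * x j) = - \<gamma> * comm.flow (\<lambda>k. x k + x (n + k) - x (2 * n + k)) i"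
  proof -
    have "(\<Sum>j<3 * n. A $$ (n + i, j) * x j) = - \<gamma> * comm.flow x i
        + - \<gamma> * comm.flow (\<lambda>k. x (n + k)) i + \<gamma> * comm.flow (\<lambda>k. x (2 * n + k)) i"
      using row[of 1] by (simp add: blocks_def sums)
    then show ?thesis unfolding split by (simp add: algebra_simps)
  qed
  show "(\<Sum>j<3 * n. A $$ (2 * n + i, j) * x j)
      = (KP i * (x i + x (n + i) - x (2 * n + i)) - grid.flow (\<lambda>k. x (2 * n + k)) i) / cap i"
  proof -
    have "(\<Sum>j<3 * n. A $$ (2 * n + i, j) * x j) = KP i / cap i * x i + KP i / cap i * x (n + i)
        + - (grid.flow (\<lambda>k. x (2 * n + k)) i + KP i * x (2 * n + i)) / cap i"
      using row[of 2] by (simp add: blocks_def sums)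
    then show ?thesis by (simp add: diff_divide_distrib add_divide_distrib algebra_simps)
  qed
qed

lemma A_col_sums:
  assumes i: "i < n"
  shows "(\<Sum>j<3 * n. A $$ (j, i) * y j)
      = - \<delta> * comm.flow y i - \<gamma> * comm.flow (\<lambda>k. y (n + k)) i + KP i * (y (2 * n + i) / cap i)"
    and "(\<Sum>j<3 * n. A $$ (j, n + i) * y j)
      = - \<gamma> * comm.flow (\<lambda>k. y (n + k)) i + KP i * (y (2 * n + i) / cap i)"
    and "(\<Sum>j<3 * n. A $$ (j, 2 * n + i) * y j)
      = - KV i * y i + \<gamma> * comm.flow (\<lambda>k. y (n + k)) i
        - (grid.flow (\<lambda>k. y (2 * n + k) / cap k) i + KP i * (y (2 * n + i) / cap i))"
proof -
  note sums = laplacian_block_sums[OF i] voltage_block_sums[OF i] zero_block_sums[OF i] diag_sum[OF i]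
    capacity_times_KP uminus_diag
  have col: "(\<Sum>j<3 * n. A $$ (j, q * n + i) * y j) = (\<Sum>k<n. blocks ! 0 ! q $$ (k, i) * y k)
      + (\<Sum>k<n. blocks ! 1 ! q $$ (k, i) * y (n + k)) + (\<Sum>k<n. blocks ! 2 ! q $$ (k, i) * y (2 * n + k))"
    if "q < 3" for q
    using block_matrix_col_sum[of q blocks i n y] that i
    by (simp add: A_blocks length_blocks numeral_3_eq_3 numeral_2_eq_2)
  show "(\<Sum>j<3 * n. A $$ (j, i) * y j)
      = - \<delta> * comm.flow y i - \<gamma> * comm.flow (\<lambda>k. y (n + k)) i + KP i * (y (2 * n + i) / cap i)"
    using col[of 0] by (simp add: blocks_def sums)
  show "(\<Sum>j<3 * n. A $$ (j, n + i) * y j)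
      = - \<gamma> * comm.flow (\<lambda>k. y (n + k)) i + KP i * (y (2 * n + i) / cap i)"
    using col[of 1] by (simp add: blocks_def sums)
  show "(\<Sum>j<3 * n. A $$ (j, 2 * n + i) * y j)
      = - KV i * y i + \<gamma> * comm.flow (\<lambda>k. y (n + k)) i
        - (grid.flow (\<lambda>k. y (2 * n + k) / cap k) i + KP i * (y (2 * n + i) / cap i))"
    using col[of 2] by (simp add: blocks_def sums)
qed

lemma sum_KV_pos: "0 < (\<Sum>i<n. KV i)" and sum_KP_pos: "0 < (\<Sum>i<n. KP i)"
  using n_pos KV_pos KP_pos by (auto intro!: sum_pos)

text \<open>
  The second block row makes \<open>Vbar + Vhat - V\<close> a constant \<open>\<alpha>\<close>. Summing the third block row, where the
  flow drops out, gives \<open>\<alpha> = 0\<close>, so \<open>V\<close> is a constant \<open>\<beta>\<close>; summing the first gives \<open>\<beta> = 0\<close>, and \<open>Vbar\<close>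
  is constant.
\<close>

lemma A_right_kernel:
  assumes x: "\<And>i. i < 3 * n \<Longrightarrow> (\<Sum>j<3 * n. A $$ (i, j) * x j) = 0"
  shows "\<exists>\<kappa>. \<forall>j<3 * n. x j = \<kappa> * stack n (\<lambda>_. 1) (\<lambda>_. - 1) (\<lambda>_. 0) j"
proof -
  have row0: "\<delta> * comm.flow x i = - KV i * x (2 * n + i)" if "i < n" for i
    using x[of i] A_row_sums(1)[OF that, of x] that by simp
  have "\<forall>i<n. comm.flow (\<lambda>k. x k + x (n + k) - x (2 * n + k)) i = 0"
    using x[of "n + _"] A_row_sums(2)[of _ x] \<gamma>_pos by simp
  then obtain \<alpha> where \<alpha>: "\<And>i. i < n \<Longrightarrow> x i + x (n + i) - x (2 * n + i) = \<alpha>"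
    using comm.flow_zero_imp_const by blast
  have flow: "grid.flow (\<lambda>k. x (2 * n + k)) i = KP i * \<alpha>" if "i < n" for i
    using x[of "2 * n + i"] A_row_sums(3)[OF that, of x] that cap_pos[OF that] \<alpha>[OF that] by simp
  then have "\<alpha> * (\<Sum>i<n. KP i) = 0"
    using grid.sum_flow[of "\<lambda>k. x (2 * n + k)"] by (simp add: sum_distrib_left mult.commute)
  then have "\<alpha> = 0" using sum_KP_pos by simp
  then obtain \<beta> where \<beta>: "\<And>i. i < n \<Longrightarrow> x (2 * n + i) = \<beta>"
    using grid.flow_zero_imp_const[of "\<lambda>k. x (2 * n + k)"] flow by auto
  have "- \<beta> * (\<Sum>i<n. KV i) = (\<Sum>i<n. \<delta> * comm.flow x i)"
    using row0 \<beta> by (simp add: sum_distrib_left mult.commute sum_negf)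
  then have "\<beta> = 0" using sum_KV_pos by (simp add: sum_distrib_left[symmetric] comm.sum_flow)
  then have "\<forall>i<n. comm.flow x i = 0" using row0 \<beta> \<delta>_pos by simp
  then obtain \<kappa> where \<kappa>: "\<And>i. i < n \<Longrightarrow> x i = \<kappa>" using comm.flow_zero_imp_const by blast
  have "x j = \<kappa> * stack n (\<lambda>_. 1) (\<lambda>_. - 1) (\<lambda>_. 0) j" if "j < 3 * n" for j
    using that
  proof (cases rule: three_blocks_cases)
    case (1 k)
    then show ?thesis using \<kappa> by (simp add: stack_simps)
  next
    case (2 k)
    then show ?thesis using \<kappa>[of k] \<alpha>[of k] \<beta>[of k] \<open>\<alpha> = 0\<close> \<open>\<beta> = 0\<close> by (simp add: stack_simps)
  next
    case (3 k)
    then show ?thesis using \<beta>[of k] \<open>\<beta> = 0\<close> by (simp add: stack_simps)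
  qed
  then show ?thesis by blast
qed

text \<open>
  The difference of the first two block columns makes the first block constant. The second block column
  turns the third into a statement about the grid flow alone; summing it makes the first block vanish
  and the third block, divided by the capacities, constant. Summing the second block column makes the
  third block vanish, so the second block is constant.
\<close>

lemma A_left_kernel:
  assumes y: "\<And>j. j < 3 * n \<Longrightarrow> (\<Sum>i<3 * n. A $$ (i, j) * y i) = 0"
  shows "\<exists>\<kappa>. \<forall>j<3 * n. y j = \<kappa> * stack n (\<lambda>_. 0) (\<lambda>_. 1) (\<lambda>_. 0) j"
proof -
  let ?s = "\<lambda>k. y (2 * n + k) / cap k"
  have col1: "\<gamma> * comm.flow (\<lambda>k. y (n + k)) i = KP i * ?s i" if "i < n" for i
    using y[of "n + i"] A_col_sums(2)[OF that, of y] that by simp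
  have "\<forall>i<n. comm.flow y i = 0"
  proof (intro allI impI)
    fix i assume "i < n"
    then show "comm.flow y i = 0"
      using y[of i] A_col_sums(1)[of i y] col1[of i] \<delta>_pos by simp
  qed
  then obtain a where a: "\<And>i. i < n \<Longrightarrow> y i = a" using comm.flow_zero_imp_const by blast
  have grid: "grid.flow ?s i = - KV i * a" if "i < n" for i
    using y[of "2 * n + i"] A_col_sums(3)[OF that, of y] that col1[OF that] a[OF that] by simp
  then have "- a * (\<Sum>i<n. KV i) = (\<Sum>i<n. grid.flow ?s i)"
    by (simp add: sum_distrib_left mult.commute sum_negf)
  then have "a = 0" using sum_KV_pos by (simp add: grid.sum_flow)
  then obtain b where b: "\<And>i. i < n \<Longrightarrow> ?s i = b"
    using grid.flow_zero_imp_const[of ?s] grid by auto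
  have "b * (\<Sum>i<n. KP i) = (\<Sum>i<n. \<gamma> * comm.flow (\<lambda>k. y (n + k)) i)"
    unfolding sum_distrib_left by (rule sum.cong[OF refl]) (simp add: col1 b del: times_divide_eq_right)
  then have "b = 0" using sum_KP_pos by (simp add: sum_distrib_left[symmetric] comm.sum_flow)
  then have "\<forall>i<n. comm.flow (\<lambda>k. y (n + k)) i = 0" using col1 b \<gamma>_pos by simp
  then obtain \<kappa> where \<kappa>: "\<And>i. i < n \<Longrightarrow> y (n + i) = \<kappa>"
    using comm.flow_zero_imp_const[of "\<lambda>k. y (n + k)"] by blast
  have "y j = \<kappa> * stack n (\<lambda>_. 0) (\<lambda>_. 1) (\<lambda>_. 0) j" if "j < 3 * n" for j
    using that
  proof (cases rule: three_blocks_cases)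
    case (1 k)
    then show ?thesis using a[of k] \<open>a = 0\<close> by (simp add: stack_simps)
  next
    case (2 k)
    then show ?thesis using \<kappa>[of k] by (simp add: stack_simps)
  next
    case (3 k)
    then show ?thesis using b[of k] cap_pos[of k] \<open>b = 0\<close> by (simp add: stack_simps)
  qed
  then show ?thesis by blast
qed

sublocale simple_kernel "3 * n" A "stack n (\<lambda>_. 1) (\<lambda>_. - 1) (\<lambda>_. 0)" "stack n (\<lambda>_. 0) (\<lambda>_. 1) (\<lambda>_. 0)"
proof
  show "A \<in> carrier_mat (3 * n) (3 * n)" by (rule A_carrier)
next
  fix i assume "i < 3 * n"
  then show "(\<Sum>j<3 * n. A $$ (i, j) * stack n (\<lambda>_. 1) (\<lambda>_. - 1) (\<lambda>_. 0) j) = 0"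
  proof (cases rule: three_blocks_cases)
    case (1 k)
    then show ?thesis
      by (simp add: A_row_sums stack_simps comm.flow_const[of "stack n (\<lambda>_. 1) (\<lambda>_. - 1) (\<lambda>_. 0)" 1])
  next
    case (2 k)
    then show ?thesis
      by (simp only: A_row_sums) (subst comm.flow_const[where \<kappa> = 0], simp_all add: stack_simps)
  next
    case (3 k)
    then show ?thesis
      by (simp only: A_row_sums) (subst grid.flow_const[where \<kappa> = 0], simp_all add: stack_simps)
  qed
next
  show "(\<Sum>i<3 * n. stack n (\<lambda>_. 0) (\<lambda>_. 1) (\<lambda>_. 0) i * stack n (\<lambda>_. 1) (\<lambda>_. - 1) (\<lambda>_. 0) i) \<noteq> (0 :: real)"
    using n_pos by (simp add: sum_three_blocks stack_simps)
qed (fact A_right_kernel A_left_kernel)+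

end

section \<open>Limits of trajectories\<close>

lemma convergent_continuous_bounded:
  fixes g :: "real \<Rightarrow> real"
  assumes cont: "continuous_on {0..} g" and lim: "(g \<longlongrightarrow> l) at_top"
  shows "\<exists>B. \<forall>t\<ge>0. \<bar>g t\<bar> \<le> B"
proof -
  have "\<forall>\<^sub>F t in at_top. dist (g t) l < 1" using lim by (rule tendstoD) simp
  then obtain T where T: "\<And>t. T \<le> t \<Longrightarrow> dist (g t) l < 1" by (auto simp: eventually_at_top_linorder)
  have "continuous_on {0..max T 0} (\<lambda>t. \<bar>g t\<bar>)"
    using continuous_on_subset[OF cont] by (intro continuous_intros) auto
  then obtain s where s: "\<forall>t\<in>{0..max T 0}. \<bar>g t\<bar> \<le> \<bar>g s\<bar>"
    using continuous_attains_sup[of "{0..max T 0}" "\<lambda>t. \<bar>g t\<bar>"] by auto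
  have "\<bar>g t\<bar> \<le> max \<bar>g s\<bar> (\<bar>l\<bar> + 1)" if "0 \<le> t" for t
    using s[rule_format, of t] T[of t] that by (cases "t \<le> T") (auto simp: dist_real_def)
  then show ?thesis by blast
qed

context closed_loop
begin

text \<open>
  The input \<open>(KV Vnom, 0, I / cap)\<close> pairs to zero with the left null vector \<open>(0, 1, 0)\<close>, which yields
  convergence. The limits solve the equilibrium equations since the derivatives, being affine in the
  state, converge too and must converge to zero.
\<close>

lemma trajectory_limits:
  assumes stable: "\<And>z. z \<in># eigenvalue_mset (map_mat complex_of_real A) - {#0#} \<Longrightarrow> Re z < 0"
    and V: "\<And>i t. i < n \<Longrightarrow> 0 < t \<Longrightarrow>
      ((\<lambda>s. V s i) has_real_derivative (- grid.flow (V t) i + I i - KP i * (V t i - Vhat t i - Vbar t i)) / cap i) (at t)"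
    and Vhat: "\<And>i t. i < n \<Longrightarrow> 0 < t \<Longrightarrow>
      ((\<lambda>s. Vhat s i) has_real_derivative - \<gamma> * comm.flow (\<lambda>k. Vhat t k + Vbar t k - V t k) i) (at t)"
    and Vbar: "\<And>i t. i < n \<Longrightarrow> 0 < t \<Longrightarrow>
      ((\<lambda>s. Vbar s i) has_real_derivative - KV i * (V t i - Vnom i) - \<delta> * comm.flow (Vbar t) i) (at t)"
  obtains a b v where
    "\<And>i. i < n \<Longrightarrow> ((\<lambda>t. Vbar t i) \<longlongrightarrow> a i) at_top"
    "\<And>i. i < n \<Longrightarrow> ((\<lambda>t. Vhat t i) \<longlongrightarrow> b i) at_top"
    "\<And>i. i < n \<Longrightarrow> ((\<lambda>t. V t i) \<longlongrightarrow> v i) at_top"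
    "\<And>i. i < n \<Longrightarrow> KV i * (v i - Vnom i) = - \<delta> * comm.flow a i"
    "\<And>i. i < n \<Longrightarrow> comm.flow (\<lambda>k. a k + b k - v k) i = 0"
    "\<And>i. i < n \<Longrightarrow> grid.flow v i = I i - KP i * (v i - b i - a i)"
proof -
  define x where "x j t = stack n (Vbar t) (Vhat t) (V t) j" for j t
  define \<beta> where "\<beta> = stack n (\<lambda>i. KV i * Vnom i) (\<lambda>_. 0) (\<lambda>i. I i / cap i)"
  have blocks: "x k t = Vbar t k" "x (n + k) t = Vhat t k" "x (2 * n + k) t = V t k" if "k < n" for k t
    using that by (simp_all add: x_def stack_simps)
  have comm_cong: "comm.flow y i = comm.flow y' i" if "i < n" "\<And>k. k < n \<Longrightarrow> y k = y' k" for y y' i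
    unfolding comm.flow_def using that by (intro sum.cong) (auto dest: comm.edge_bounds)
  have grid_cong: "grid.flow y i = grid.flow y' i" if "i < n" "\<And>k. k < n \<Longrightarrow> y k = y' k" for y y' i
    unfolding grid.flow_def using that by (intro sum.cong) (auto dest: grid.edge_bounds)
  have deriv: "(x j has_real_derivative (\<Sum>k<3 * n. A $$ (j, k) * x k t) + \<beta> j) (at t)"
    if j: "j < 3 * n" and t: "0 < t" for j t
    using j
  proof (cases rule: three_blocks_cases)
    case (1 i)
    have "comm.flow (\<lambda>j. x j t) i = comm.flow (Vbar t) i"
      using 1 by (intro comm_cong) (simp_all add: blocks)
    then have "(\<Sum>k<3 * n. A $$ (j, k) * x k t) + \<beta> j
        = - KV i * (V t i - Vnom i) - \<delta> * comm.flow (Vbar t) i"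
      using 1 by (simp add: A_row_sums blocks \<beta>_def stack_simps right_diff_distrib)
    moreover have "x j = (\<lambda>s. Vbar s i)" using 1 by (simp add: blocks fun_eq_iff)
    ultimately show ?thesis using Vbar[OF 1(1) t] by (simp only:)
  next
    case (2 i)
    have "comm.flow (\<lambda>k. x k t + x (n + k) t - x (2 * n + k) t) i = comm.flow (\<lambda>k. Vhat t k + Vbar t k - V t k) i"
      using 2 by (intro comm_cong) (simp_all add: blocks)
    moreover have "x j = (\<lambda>s. Vhat s i)" using 2 by (simp add: blocks fun_eq_iff)
    ultimately show ?thesis
      using Vhat[OF 2(1) t] 2 by (simp add: A_row_sums \<beta>_def stack_simps)
  next
    case (3 i)
    have "grid.flow (\<lambda>k. x (2 * n + k) t) i = grid.flow (V t) i"
      using 3 by (intro grid_cong) (simp_all add: blocks)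
    moreover have "x j = (\<lambda>s. V s i)" using 3 by (simp add: blocks fun_eq_iff)
    moreover have "(KP i * (Vbar t i + Vhat t i - V t i) - grid.flow (V t) i) / cap i + I i / cap i
        = (- grid.flow (V t) i + I i - KP i * (V t i - Vhat t i - Vbar t i)) / cap i"
      by (simp add: add_divide_distrib[symmetric] algebra_simps)
    ultimately show ?thesis
      using V[OF 3(1) t] 3 by (simp add: A_row_sums \<beta>_def stack_simps blocks)
  qed
  have "(\<Sum>j<3 * n. stack n (\<lambda>_. 0) (\<lambda>_. 1) (\<lambda>_. 0) j * \<beta> j) = 0"
    by (simp add: sum_three_blocks stack_simps \<beta>_def)
  then have "\<exists>l. (x j \<longlongrightarrow> l) at_top" if "j < 3 * n" for j
    using solution_converges[OF stable _ deriv that] by blast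
  then have "\<forall>j\<in>{..<3 * n}. \<exists>l. (x j \<longlongrightarrow> l) at_top" by blast
  then obtain l where "\<forall>j\<in>{..<3 * n}. (x j \<longlongrightarrow> l j) at_top"
    using bchoice[of "{..<3 * n}" "\<lambda>j l. (x j \<longlongrightarrow> l) at_top"] by blast
  then have l: "(x j \<longlongrightarrow> l j) at_top" if "j < 3 * n" for j using that by blast
  have equilibrium: "(\<Sum>k<3 * n. A $$ (j, k) * l k) + \<beta> j = 0" if j: "j < 3 * n" for j
  proof (rule derivative_limit_eq_0[OF deriv[OF j] l[OF j]])
    show "((\<lambda>t. (\<Sum>k<3 * n. A $$ (j, k) * x k t) + \<beta> j) \<longlongrightarrow> (\<Sum>k<3 * n. A $$ (j, k) * l k) + \<beta> j) at_top"
      using l by (intro tendsto_add tendsto_sum tendsto_mult tendsto_const) blast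
  qed
  define a b v where "a = l" and "b k = l (n + k)" and "v k = l (2 * n + k)" for k
  show ?thesis
  proof (rule that)
    fix i assume i: "i < n"
    show "((\<lambda>t. Vbar t i) \<longlongrightarrow> a i) at_top" "((\<lambda>t. Vhat t i) \<longlongrightarrow> b i) at_top" "((\<lambda>t. V t i) \<longlongrightarrow> v i) at_top"
      using l[of i] l[of "n + i"] l[of "2 * n + i"] i
      by (simp_all add: a_def b_def v_def x_def[abs_def] stack_simps)
    show "KV i * (v i - Vnom i) = - \<delta> * comm.flow a i"
      using equilibrium[of i] A_row_sums(1)[OF i, of l] i
      by (simp add: a_def v_def \<beta>_def stack_simps algebra_simps)
    show "comm.flow (\<lambda>k. a k + b k - v k) i = 0"
      using equilibrium[of "n + i"] A_row_sums(2)[OF i, of l] i \<gamma>_pos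
      by (simp add: a_def b_def v_def \<beta>_def stack_simps)
    show "grid.flow v i = I i - KP i * (v i - b i - a i)"
    proof -
      have "((KP i * (a i + b i - v i) - grid.flow v i) + I i) / cap i = 0"
        using equilibrium[of "2 * n + i"] A_row_sums(3)[OF i, of l] i
        by (simp add: a_def b_def v_def[abs_def] \<beta>_def stack_simps add_divide_distrib)
      then show ?thesis using cap_pos[OF i] by (simp add: algebra_simps)
    qed
  qed
qed

end

theorem theorem1:
  fixes n :: nat
    and EL EC :: "nat rel"
    and R c :: "nat \<Rightarrow> nat \<Rightarrow> real"
    and cap f KP KV :: "nat \<Rightarrow> real"
    and \<gamma> \<delta> :: real
    and Iinj Vnom :: "real vec"
    and LR LC A :: "real mat"
  assumes "0 < n"
    and "undirected_connected_graph n EL" and "edge_weights EL R"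
    and "undirected_connected_graph n EC" and "edge_weights EC c"
    and "\<forall>i<n. 0 < cap i" and "\<forall>i<n. 0 < KP i" and "\<forall>i<n. 0 < KV i"
    and "0 < \<gamma>" and "0 < \<delta>"
    and "Iinj \<in> carrier_vec n" and "Vnom \<in> carrier_vec n"
    and "\<forall>i<n. 0 < f i"
    and "inverts_mat (mat_diag n f) (mat_diag n KP)"
    and "inverts_mat (mat_diag n KP) (mat_diag n f)"
    and "LR = weighted_laplacian n EL (\<lambda>i j. 1 / R i j)"
    and "LC = weighted_laplacian n EC c"
    and "A = closed_loop_matrix n \<gamma> \<delta> LR LC (capacity_matrix n cap) (mat_diag n KP) (mat_diag n KV)"
  shows "count (eigenvalue_mset (map_mat complex_of_real A)) 0 = 1 \<and>
    ((\<forall>z \<in># eigenvalue_mset (map_mat complex_of_real A) - {#0#}. Re z < 0) \<longrightarrow>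
     (\<forall>V Vhat Vbar u :: real \<Rightarrow> nat \<Rightarrow> real.
        (\<forall>t\<ge>0. \<forall>i<n.
           ((\<lambda>s. V s i) has_real_derivative
              (- (\<Sum>j\<in>EL `` {i}. 1 / R i j * (V t i - V t j)) + Iinj $ i + u t i) / cap i)
              (at t within {0..}) \<and>
           u t i = - KP i * (V t i - Vhat t i - Vbar t i) \<and>
           ((\<lambda>s. Vhat s i) has_real_derivative
              - \<gamma> * (\<Sum>j\<in>EC `` {i}. c i j *
                  ((Vhat t i + Vbar t i - V t i) - (Vhat t j + Vbar t j - V t j))))
              (at t within {0..}) \<and>
           ((\<lambda>s. Vbar s i) has_real_derivative
              - KV i * (V t i - Vnom $ i) - \<delta> * (\<Sum>j\<in>EC `` {i}. c i j * (Vbar t i - Vbar t j)))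
              (at t within {0..})) \<longrightarrow>
        ((\<lambda>t. \<Sum>i<n. KV i * (V t i - Vnom $ i)) \<longlongrightarrow> 0) at_top \<and>
        (\<exists>ustar.
           (\<forall>u'. (\<exists>V'. optimal_injection n f LR Iinj (u', V')) \<longleftrightarrow> u' = ustar) \<and>
           (\<forall>i<n. ((\<lambda>t. u t i) \<longlongrightarrow> ustar $ i) at_top) \<and>
           (\<forall>i<n. \<forall>j<n.
              (\<exists>B. \<forall>t\<ge>0. \<bar>V t i - V t j\<bar> \<le> B) \<and>
              (\<exists>d. ((\<lambda>t. \<bar>V t i - V t j\<bar>) \<longlongrightarrow> d) at_top \<and>
                   d \<le> 2 * Max ((\<lambda>k. \<bar>(Iinj + ustar) $ k\<bar>) ` {..<n}) *
                       (\<Sum>k = 2..n. 1 / ordered_eigenvalue LR k))))))"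
proof -
  interpret loop: closed_loop n EL EC R c cap KP KV \<gamma> \<delta>
    using assms by unfold_locales (auto simp: edge_weights_def)
  have A: "A = loop.A" and LR: "LR = loop.grid.laplacian" using assms by simp_all
  note unfold_flow = loop.grid.flow_def loop.comm.flow_def
  show ?thesis
  proof (intro conjI impI allI)
    show "count (eigenvalue_mset (map_mat complex_of_real A)) 0 = 1"
      unfolding A by (rule loop.zero_eigenvalue_simple)
  next
    fix V Vhat Vbar u :: "real \<Rightarrow> nat \<Rightarrow> real"
    assume stable: "\<forall>z \<in># eigenvalue_mset (map_mat complex_of_real A) - {#0#}. Re z < 0"
      and sol: "\<forall>t\<ge>0. \<forall>i<n.
           ((\<lambda>s. V s i) has_real_derivative
              (- (\<Sum>j\<in>EL `` {i}. 1 / R i j * (V t i - V t j)) + Iinj $ i + u t i) / cap i)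
              (at t within {0..}) \<and>
           u t i = - KP i * (V t i - Vhat t i - Vbar t i) \<and>
           ((\<lambda>s. Vhat s i) has_real_derivative
              - \<gamma> * (\<Sum>j\<in>EC `` {i}. c i j *
                  ((Vhat t i + Vbar t i - V t i) - (Vhat t j + Vbar t j - V t j))))
              (at t within {0..}) \<and>
           ((\<lambda>s. Vbar s i) has_real_derivative
              - KV i * (V t i - Vnom $ i) - \<delta> * (\<Sum>j\<in>EC `` {i}. c i j * (Vbar t i - Vbar t j)))
              (at t within {0..})"
    have at: "at t within {0..} = at t" if "0 < t" for t :: real
      using that by (intro at_within_open_subset[of t "{0<..}"]) auto
    have u: "u t i = - KP i * (V t i - Vhat t i - Vbar t i)" if "i < n" "0 \<le> t" for i t
      using sol that by blast
    obtain a b v where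
      lim_a: "\<And>i. i < n \<Longrightarrow> ((\<lambda>t. Vbar t i) \<longlongrightarrow> a i) at_top" and
      lim_b: "\<And>i. i < n \<Longrightarrow> ((\<lambda>t. Vhat t i) \<longlongrightarrow> b i) at_top" and
      lim_v: "\<And>i. i < n \<Longrightarrow> ((\<lambda>t. V t i) \<longlongrightarrow> v i) at_top" and
      eq_a: "\<And>i. i < n \<Longrightarrow> KV i * (v i - Vnom $ i) = - \<delta> * loop.comm.flow a i" and
      eq_b: "\<And>i. i < n \<Longrightarrow> loop.comm.flow (\<lambda>k. a k + b k - v k) i = 0" and
      eq_v: "\<And>i. i < n \<Longrightarrow> loop.grid.flow v i = Iinj $ i - KP i * (v i - b i - a i)"
    proof (rule loop.trajectory_limits[of V "\<lambda>i. Iinj $ i" Vhat Vbar "\<lambda>i. Vnom $ i"])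
      show "Re z < 0" if "z \<in># eigenvalue_mset (map_mat complex_of_real loop.A) - {#0#}" for z
        using stable that unfolding A by blast
    next
      fix i t assume i: "i < n" and t: "0 < (t :: real)"
      note sol' = sol[rule_format, OF less_imp_le[OF t] i, unfolded at[OF t]]
      show "((\<lambda>s. V s i) has_real_derivative
          (- loop.grid.flow (V t) i + Iinj $ i - KP i * (V t i - Vhat t i - Vbar t i)) / cap i) (at t)"
        using sol'[THEN conjunct1] u[OF i less_imp_le[OF t]] by (simp add: unfold_flow algebra_simps)
      show "((\<lambda>s. Vhat s i) has_real_derivative
          - \<gamma> * loop.comm.flow (\<lambda>k. Vhat t k + Vbar t k - V t k) i) (at t)"
        using sol' by (simp add: unfold_flow)
      show "((\<lambda>s. Vbar s i) has_real_derivative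
          - KV i * (V t i - Vnom $ i) - \<delta> * loop.comm.flow (Vbar t) i) (at t)"
        using sol' by (simp add: unfold_flow)
    qed blast
    obtain \<alpha> where \<alpha>: "\<And>i. i < n \<Longrightarrow> a i + b i - v i = \<alpha>"
      using loop.comm.flow_zero_imp_const eq_b by blast
    \<comment> \<open>The limit of \<open>u = KP (Vhat + Vbar - V)\<close>; its marginal costs are all \<open>\<alpha>\<close> because \<open>f\<close> and \<open>KP\<close>
      are reciprocal.\<close>
    define us where "us = vec n (\<lambda>i. KP i * \<alpha>)"
    have us: "us \<in> carrier_vec n" "\<And>i. i < n \<Longrightarrow> us $ i = KP i * \<alpha>" by (simp_all add: us_def)
    have eq_v': "loop.grid.flow v i = (Iinj + us) $ i" if "i < n" for i
    proof -
      have "- KP i * (v i - b i - a i) = KP i * (a i + b i - v i)" by (simp add: algebra_simps)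
      then show ?thesis using eq_v[OF that] \<alpha>[OF that] us(2)[OF that] us(1) that by simp
    qed
    have "((\<lambda>t. \<Sum>i<n. KV i * (V t i - Vnom $ i)) \<longlongrightarrow> (\<Sum>i<n. KV i * (v i - Vnom $ i))) at_top"
      using lim_v by (intro tendsto_sum tendsto_mult tendsto_diff tendsto_const) blast
    also have "(\<Sum>i<n. KV i * (v i - Vnom $ i)) = 0"
      using eq_a by (simp add: sum_negf sum_distrib_left[symmetric] loop.comm.sum_flow)
    finally show "((\<lambda>t. \<Sum>i<n. KV i * (V t i - Vnom $ i)) \<longlongrightarrow> 0) at_top" .
    show "\<exists>ustar.
           (\<forall>u'. (\<exists>V'. optimal_injection n f LR Iinj (u', V')) \<longleftrightarrow> u' = ustar) \<and>
           (\<forall>i<n. ((\<lambda>t. u t i) \<longlongrightarrow> ustar $ i) at_top) \<and>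
           (\<forall>i<n. \<forall>j<n.
              (\<exists>B. \<forall>t\<ge>0. \<bar>V t i - V t j\<bar> \<le> B) \<and>
              (\<exists>d. ((\<lambda>t. \<bar>V t i - V t j\<bar>) \<longlongrightarrow> d) at_top \<and>
                   d \<le> 2 * Max ((\<lambda>k. \<bar>(Iinj + ustar) $ k\<bar>) ` {..<n}) *
                       (\<Sum>k = 2..n. 1 / ordered_eigenvalue LR k)))"
    proof (intro exI[of _ us] conjI allI impI)
      fix u'
      show "(\<exists>V'. optimal_injection n f LR Iinj (u', V')) \<longleftrightarrow> u' = us"
        unfolding LR
      proof (rule loop.grid.optimal_injection_iff[OF _ us(1), of _ "vec n v"])
        show "loop.grid.laplacian *\<^sub>v vec n v = Iinj + us"
        proof (subst loop.grid.laplacian_mult_vec_iff, goal_cases)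
          case 3
          have "loop.grid.flow (\<lambda>k. vec n v $ k) i = loop.grid.flow v i" if "i < n" for i
            unfolding loop.grid.flow_def using that by (intro sum.cong) (auto dest: loop.grid.edge_bounds)
          then show ?case using eq_v' by simp
        qed (use us(1) assms(11) in auto)
        fix i assume i: "i < n"
        have "(mat_diag n f * mat_diag n KP) $$ (i, i) = 1"
          using assms(14) i by (simp add: inverts_mat_def mat_diag_def)
        then have "f i * KP i = 1" unfolding mat_diag_diag using i by (simp add: mat_diag_def)
        then show "f i * us $ i = \<alpha>" using us(2)[OF i] by (simp add: mult.assoc[symmetric])
      qed (use assms in auto)
    next
      fix i assume i: "i < n"
      have "((\<lambda>t. - KP i * (V t i - Vhat t i - Vbar t i)) \<longlongrightarrow> - KP i * (v i - b i - a i)) at_top"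
        using lim_v[OF i] lim_b[OF i] lim_a[OF i] by (intro tendsto_intros)
      also have "- KP i * (v i - b i - a i) = KP i * (a i + b i - v i)" by (simp add: algebra_simps)
      also have "\<dots> = us $ i" using \<alpha>[OF i] us(2)[OF i] by simp
      finally show "((\<lambda>t. u t i) \<longlongrightarrow> us $ i) at_top"
        by (rule Lim_transform_eventually)
          (auto intro: eventually_mono[OF eventually_ge_at_top[of 0]] simp: u[OF i])
    next
      fix i j assume i: "i < n" and j: "j < n"
      have lim: "((\<lambda>t. V t i - V t j) \<longlongrightarrow> v i - v j) at_top"
        using lim_v[OF i] lim_v[OF j] by (rule tendsto_diff)
      have "continuous_on {0..} (\<lambda>t. V t k)" if "k < n" for k
        unfolding continuous_on_eq_continuous_within
        using sol that by (auto intro!: DERIV_continuous)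
      then have "continuous_on {0..} (\<lambda>t. V t i - V t j)"
        using i j by (intro continuous_on_diff) auto
      then show "\<exists>B. \<forall>t\<ge>0. \<bar>V t i - V t j\<bar> \<le> B"
        using convergent_continuous_bounded lim by blast
      have "\<bar>v i - v j\<bar> \<le> 2 * Max ((\<lambda>k. \<bar>(Iinj + us) $ k\<bar>) ` {..<n})
          * (\<Sum>k = 2..n. 1 / ordered_eigenvalue LR k)"
        unfolding LR
      proof (rule loop.grid.potential_difference_bound[of v "\<lambda>k. (Iinj + us) $ k", OF eq_v' _ i j])
        fix k assume "k < n"
        then show "\<bar>(Iinj + us) $ k\<bar> \<le> Max ((\<lambda>k. \<bar>(Iinj + us) $ k\<bar>) ` {..<n})"
          by (intro Max_ge) auto
      qed
      then show "\<exists>d. ((\<lambda>t. \<bar>V t i - V t j\<bar>) \<longlongrightarrow> d) at_top \<and>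
          d \<le> 2 * Max ((\<lambda>k. \<bar>(Iinj + us) $ k\<bar>) ` {..<n}) * (\<Sum>k = 2..n. 1 / ordered_eigenvalue LR k)"
        using tendsto_rabs[OF lim] by blast
    qed
  qed
qed

end
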